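(* For every finite group $G$ there exists a minimal substitutive subshift $(X,\sigma)$ such that $\mathrm{Aut}(X,\sigma)$ is isomorphic to $\mathbb Z\oplus G$.
   Context: Let $\mathcal A$ be a finite alphabet and $\mathcal A^*$ the free monoid of words. A substitution is a map $\tau:\mathcal A\to\mathcal A^*$, extended to words by concatenation, such that $|\tau^n(a)|\to\infty$ for every $a\in\mathcal A$. The subshift induced by $\tau$ is $X_\tau=\{x\in\mathcal A^{\mathbb Z}:$ each finite word of $x$ is a subword of $\tau^n(a)$ for some $n\ge1$, $a\in\mathcal A\}$, with the shift map $\sigma((x_n)_n)=(x_{n+1})_n$; a subshift of the form $(X_\tau,\sigma)$ is called substitutive. It is minimal if every $\sigma$-orbit is dense. $\mathrm{Aut}(X,\sigma)$ is the group of homeomorphisms of $X$ commuting with $\sigma$. *)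

theory Defs
  imports
    "HOL-Algebra.Bij"
    "HOL-Algebra.Elementary_Groups"
    "HOL-Analysis.Function_Topology"
    "HOL-Library.Sublist"
begin

definition subst_ext :: "('a \<Rightarrow> 'a list) \<Rightarrow> 'a list \<Rightarrow> 'a list" where
  "subst_ext \<tau> w = concat (map \<tau> w)"

definition substitution :: "'a set \<Rightarrow> ('a \<Rightarrow> 'a list) \<Rightarrow> bool" where
  "substitution A \<tau> \<longleftrightarrow>
     finite A \<and> A \<noteq> {} \<and> \<tau> \<in> A \<rightarrow> lists A \<and>
     (\<forall>a\<in>A. filterlim (\<lambda>n. length ((subst_ext \<tau> ^^ n) [a])) at_top sequentially)"

definition factor_at :: "(int \<Rightarrow> 'a) \<Rightarrow> int \<Rightarrow> nat \<Rightarrow> 'a list" where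
  "factor_at x i l = map (\<lambda>k. x (i + int k)) [0..<l]"

definition subst_shift :: "'a set \<Rightarrow> ('a \<Rightarrow> 'a list) \<Rightarrow> (int \<Rightarrow> 'a) set" where
  "subst_shift A \<tau> =
     {x \<in> UNIV \<rightarrow> A. \<forall>i l. \<exists>n\<ge>1. \<exists>a\<in>A. sublist (factor_at x i l) ((subst_ext \<tau> ^^ n) [a])}"

definition shift :: "(int \<Rightarrow> 'a) \<Rightarrow> int \<Rightarrow> 'a" where
  "shift x = (\<lambda>n. x (n + 1))"

definition shift_orbit :: "(int \<Rightarrow> 'a) \<Rightarrow> (int \<Rightarrow> 'a) set" where
  "shift_orbit x = range (\<lambda>m n. x (n + m))"

lemma funpow_shift: "(shift ^^ m) x = (\<lambda>n. x (n + int m))"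
  by (induction m) (auto simp: shift_def algebra_simps)

text \<open>The orbit is two-sided: it consists of all forward and backward iterates of the shift.\<close>

lemma shift_orbit_iterates:
  "shift_orbit x = {y. \<exists>m. y = (shift ^^ m) x \<or> x = (shift ^^ m) y}"
proof (intro equalityI subsetI)
  fix y assume "y \<in> shift_orbit x"
  then obtain k where y: "y = (\<lambda>n. x (n + k))"
    by (auto simp: shift_orbit_def)
  show "y \<in> {y. \<exists>m. y = (shift ^^ m) x \<or> x = (shift ^^ m) y}"
    unfolding mem_Collect_eq funpow_shift y
    by (rule exI[of _ "nat \<bar>k\<bar>"]) (cases "k \<ge> 0"; simp)
next
  fix y assume "y \<in> {y. \<exists>m. y = (shift ^^ m) x \<or> x = (shift ^^ m) y}"
  then obtain m where "y = (\<lambda>n. x (n + int m)) \<or> x = (\<lambda>n. y (n + int m))"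
    by (auto simp: funpow_shift)
  then have "y = (\<lambda>n. x (n + int m)) \<or> y = (\<lambda>n. x (n + - int m))"
    by auto
  then show "y \<in> shift_orbit x"
    unfolding shift_orbit_def by blast
qed

definition shift_topology :: "'a set \<Rightarrow> (int \<Rightarrow> 'a) set \<Rightarrow> (int \<Rightarrow> 'a) topology" where
  "shift_topology A X = subtopology (product_topology (\<lambda>_. discrete_topology A) UNIV) X"

definition minimal_shift :: "'a set \<Rightarrow> (int \<Rightarrow> 'a) set \<Rightarrow> bool" where
  "minimal_shift A X \<longleftrightarrow> (\<forall>x\<in>X. shift_topology A X closure_of shift_orbit x = X)"

text \<open>
  Automorphisms are represented by extensional functions on \<^term>\<open>X\<close>, so that
  distinct elements of the carrier are distinct as maps on \<^term>\<open>X\<close>.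
\<close>

definition shift_aut :: "'a set \<Rightarrow> (int \<Rightarrow> 'a) set \<Rightarrow> ((int \<Rightarrow> 'a) \<Rightarrow> int \<Rightarrow> 'a) monoid" where
  "shift_aut A X = BijGroup X
     \<lparr>carrier := {f \<in> Bij X. homeomorphic_map (shift_topology A X) (shift_topology A X) f \<and>
                            (\<forall>x\<in>X. f (shift x) = shift (f x))}\<rparr>"

end

theory Submission
  imports Defs "HOL-Combinatorics.Permutations"
begin

text \<open>
  Take a constant-length substitution \<open>a \<mapsto> p 0 a \<cdots> p (L - 1) a\<close> whose columns \<open>p i\<close> are
  permutations of the alphabet \<open>S\<close> with centralizer \<open>G\<close>, a group acting freely on \<open>S\<close>.
  Composing with the letter maps of \<open>G\<close> and with shifts gives \<open>\<int> \<oplus> G\<close>; that there are no other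
  automorphisms \<open>f\<close> is seen from asymptotic pairs. Since the columns are injective, two distinct
  points that agree on a left half-line are, up to a common shift, fixed by the substitution.
  Now \<open>f\<close> maps such a pair to another one, so \<open>f u\<close> is a shift of a fixed point \<open>v\<close> for some fixed
  point \<open>u\<close>. Comparing the centres of long blocks of \<open>u\<close> and \<open>v\<close>, \<open>v\<close> arises from \<open>u\<close> by a letter
  map; it commutes with all columns, hence belongs to \<open>G\<close>, and minimality gives
  the same description of \<open>f\<close> everywhere.
\<close>

section \<open>Shift spaces\<close>

text \<open>A basic open set of the product constrains only finitely many coordinates, and these lie
  within some radius \<open>r\<close>. All later topology is thus about agreement on central
  windows.\<close>

lemma openin_shift_topology:
  assumes X: "X \<subseteq> UNIV \<rightarrow> A"
  shows "openin (shift_topology A X) U \<longleftrightarrow>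
    U \<subseteq> X \<and> (\<forall>x\<in>U. \<exists>r. \<forall>y\<in>X. (\<forall>i. \<bar>i\<bar> \<le> r \<longrightarrow> y i = x i) \<longrightarrow> y \<in> U)"
    (is "?lhs \<longleftrightarrow> ?rhs")
proof
  assume ?lhs
  then obtain V where V: "openin (product_topology (\<lambda>_::int. discrete_topology A) UNIV) V"
      and U: "U = V \<inter> X"
    unfolding shift_topology_def openin_subtopology by blast
  show ?rhs
  proof (intro conjI ballI)
    show "U \<subseteq> X" using U by blast
    fix x assume x: "x \<in> U"
    then have "x \<in> V" using U by blast
    then obtain W where fin: "finite {i \<in> UNIV. W i \<noteq> topspace (discrete_topology A)}"
        and xW: "x \<in> Pi\<^sub>E UNIV W" and W: "Pi\<^sub>E UNIV W \<subseteq> V"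
      using V unfolding openin_product_topology_alt by blast
    from fin have "finite (abs ` {i. W i \<noteq> A})" by simp
    then obtain r where r: "\<And>i. W i \<noteq> A \<Longrightarrow> \<bar>i\<bar> \<le> r"
      using Max_ge[of "abs ` {i. W i \<noteq> A}"] by blast
    show "\<exists>r. \<forall>y\<in>X. (\<forall>i. \<bar>i\<bar> \<le> r \<longrightarrow> y i = x i) \<longrightarrow> y \<in> U"
    proof (intro exI ballI impI)
      fix y assume y: "y \<in> X" "\<forall>i. \<bar>i\<bar> \<le> r \<longrightarrow> y i = x i"
      have "y i \<in> W i" for i
      proof (cases "W i = A")
        case True then show ?thesis using X y(1) by auto
      next
        case False then show ?thesis using y(2) r xW by (auto simp: PiE_def)
      qed
      then have "y \<in> V" using W by (auto simp: PiE_def)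
      then show "y \<in> U" using y U by blast
    qed
  qed
next
  assume R: ?rhs
  \<comment> \<open>The union of the cylinders of the full shift that are centred at points of
    \<open>U\<close> and whose trace on \<open>X\<close> lies in \<open>U\<close>; its intersection
    with \<open>X\<close> is \<open>U\<close> again.\<close>
  define V where "V = {z \<in> UNIV \<rightarrow> A. \<exists>x\<in>U. \<exists>r. (\<forall>y\<in>X. (\<forall>i. \<bar>i\<bar> \<le> r \<longrightarrow> y i = x i) \<longrightarrow> y \<in> U) \<and>
     (\<forall>i. \<bar>i\<bar> \<le> r \<longrightarrow> z i = x i)}"
  have "openin (product_topology (\<lambda>_::int. discrete_topology A) UNIV) V"
    unfolding openin_product_topology_alt
  proof
    fix z assume "z \<in> V"
    then obtain x r where z: "z \<in> UNIV \<rightarrow> A" and x: "x \<in> U"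
        and xr: "\<forall>y\<in>X. (\<forall>i. \<bar>i\<bar> \<le> r \<longrightarrow> y i = x i) \<longrightarrow> y \<in> U" and zx: "\<forall>i. \<bar>i\<bar> \<le> r \<longrightarrow> z i = x i"
      unfolding V_def by blast
    let ?W = "\<lambda>i::int. if \<bar>i\<bar> \<le> r then {x i} else A"
    have xA: "x i \<in> A" for i using x R X by auto
    show "\<exists>W. finite {i \<in> UNIV. W i \<noteq> topspace (discrete_topology A)} \<and>
           (\<forall>i\<in>UNIV. openin (discrete_topology A) (W i)) \<and> z \<in> Pi\<^sub>E UNIV W \<and> Pi\<^sub>E UNIV W \<subseteq> V"
    proof (intro exI[of _ ?W] conjI)
      have "{i \<in> UNIV. ?W i \<noteq> topspace (discrete_topology A)} \<subseteq> {-r..r}" by auto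
      then show "finite {i \<in> UNIV. ?W i \<noteq> topspace (discrete_topology A)}"
        using finite_subset by blast
      show "\<forall>i\<in>UNIV. openin (discrete_topology A) (?W i)" using xA by auto
      show "z \<in> Pi\<^sub>E UNIV ?W" using z zx by auto
      show "Pi\<^sub>E UNIV ?W \<subseteq> V"
      proof
        fix y assume "y \<in> Pi\<^sub>E UNIV ?W"
        then have y: "y i \<in> ?W i" for i by (rule PiE_mem) simp
        have "y i \<in> A" for i using y[of i] xA by (auto split: if_splits)
        moreover have "\<forall>i. \<bar>i\<bar> \<le> r \<longrightarrow> y i = x i" 
        proof (intro allI impI)
          fix i assume "\<bar>i\<bar> \<le> r" then show "y i = x i" using y[of i] by simp
        qed
        ultimately show "y \<in> V" unfolding V_def using x xr by blast
      qed
    qed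
  qed
  moreover have "U = V \<inter> X"
  proof
    show "U \<subseteq> V \<inter> X" using R X unfolding V_def by blast
    show "V \<inter> X \<subseteq> U" unfolding V_def by blast
  qed
  ultimately show ?lhs unfolding shift_topology_def openin_subtopology by blast
qed

lemma topspace_shift_topology:
  assumes "X \<subseteq> UNIV \<rightarrow> A"
  shows "topspace (shift_topology A X) = X"
  using assms unfolding shift_topology_def by auto

text \<open>\<open>lim\<close> says that \<open>X\<close> is closed in the full shift, and the full
  shift is compact by Tychonoff's theorem.\<close>

lemma compact_space_shift_topology:
  assumes "finite A" and X: "X \<subseteq> UNIV \<rightarrow> A"
    and lim: "\<And>z. z \<in> UNIV \<rightarrow> A \<Longrightarrow> (\<And>r. \<exists>y\<in>X. \<forall>i. \<bar>i\<bar> \<le> r \<longrightarrow> y i = z i) \<Longrightarrow> z \<in> X"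
  shows "compact_space (shift_topology A X)"
proof -
  let ?T = "product_topology (\<lambda>_::int. discrete_topology A) UNIV"
  have top: "shift_topology A (UNIV \<rightarrow> A) = ?T"
    unfolding shift_topology_def
    by (rule subtopology_superset) (simp add: PiE_UNIV_domain)
  have "compact_space ?T"
    using assms(1) by (simp add: compact_space_product_topology compact_space_discrete_topology)
  moreover have "openin ?T ((UNIV \<rightarrow> A) - X)"
    unfolding top[symmetric] openin_shift_topology[OF subset_refl]
  proof (intro conjI ballI)
    fix z assume z: "z \<in> (UNIV \<rightarrow> A) - X"
    then obtain r where r: "\<not> (\<exists>y\<in>X. \<forall>i. \<bar>i\<bar> \<le> r \<longrightarrow> y i = z i)" using lim by blast
    show "\<exists>r. \<forall>y\<in>UNIV \<rightarrow> A. (\<forall>i. \<bar>i\<bar> \<le> r \<longrightarrow> y i = z i) \<longrightarrow> y \<in> (UNIV \<rightarrow> A) - X"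
      using r by (intro exI[of _ r]) blast
  qed blast
  then have "closedin ?T X"
    using X by (simp add: closedin_def PiE_UNIV_domain)
  ultimately have "compactin ?T X" by (rule closedin_compact_space)
  then show ?thesis
    unfolding shift_topology_def by (rule compact_space_subtopology)
qed

text \<open>The compactness part of the Curtis-Hedlund-Lyndon theorem: continuity gives each point a
  radius on which the letter at 0 of its image is decided, and finitely many of the resulting
  cylinders cover \<open>X\<close>.\<close>

lemma shift_local_rule:
  assumes "compact_space (shift_topology A X)" and X: "X \<subseteq> UNIV \<rightarrow> A"
    and f: "continuous_map (shift_topology A X) (shift_topology A X) f"
  obtains r where "\<And>x y. x \<in> X \<Longrightarrow> y \<in> X \<Longrightarrow> (\<And>i. \<bar>i\<bar> \<le> r \<Longrightarrow> x i = y i) \<Longrightarrow> f x 0 = f y 0"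
proof -
  let ?T = "shift_topology A X"
  let ?C = "\<lambda>x r. {y \<in> X. \<forall>i. \<bar>i\<bar> \<le> r \<longrightarrow> y i = x i}"
  have fX: "f x \<in> X" if "x \<in> X" for x
    using f that topspace_shift_topology[OF X] by (auto simp: continuous_map_def)
  have "\<forall>x\<in>X. \<exists>r. \<forall>y\<in>?C x r. f y 0 = f x 0"
  proof
    fix x assume x: "x \<in> X"
    have "openin ?T {z \<in> X. z 0 = f x 0}"
      unfolding openin_shift_topology[OF X] by (auto intro!: exI[of _ 0])
    then have "openin ?T {y \<in> topspace ?T. f y \<in> {z \<in> X. z 0 = f x 0}}"
      using f unfolding continuous_map_def by blast
    moreover have "x \<in> {y \<in> topspace ?T. f y \<in> {z \<in> X. z 0 = f x 0}}"
      using x fX topspace_shift_topology[OF X] by simp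
    ultimately show "\<exists>r. \<forall>y\<in>?C x r. f y 0 = f x 0"
      unfolding openin_shift_topology[OF X] by blast
  qed
  from bchoice[OF this] obtain R where R: "\<And>x y. x \<in> X \<Longrightarrow> y \<in> ?C x (R x) \<Longrightarrow> f y 0 = f x 0"
    by blast
  have op: "openin ?T (?C x r)" for x r
    unfolding openin_shift_topology[OF X] by (auto intro!: exI[of _ r])
  have "topspace ?T \<subseteq> \<Union> ((\<lambda>x. ?C x (R x)) ` X)"
    unfolding topspace_shift_topology[OF X] by blast
  moreover have "\<forall>U\<in>(\<lambda>x. ?C x (R x)) ` X. openin ?T U" using op by blast
  ultimately have "\<exists>F. finite F \<and> F \<subseteq> (\<lambda>x. ?C x (R x)) ` X \<and> topspace ?T \<subseteq> \<Union> F"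
    using assms(1) unfolding compact_space_alt by meson
  then obtain F where F: "finite F" "F \<subseteq> (\<lambda>x. ?C x (R x)) ` X" "topspace ?T \<subseteq> \<Union> F"
    by (elim exE conjE) (rule that)
  from finite_subset_image[OF F(1,2)] obtain K
    where K: "K \<subseteq> X" "finite K" "F = (\<lambda>x. ?C x (R x)) ` K"
    by (elim exE conjE) (rule that)
  have cover: "X \<subseteq> (\<Union>x\<in>K. ?C x (R x))"
    using F(3) unfolding K(3) topspace_shift_topology[OF X] .
  have le: "R x \<le> Max (R ` K)" if "x \<in> K" for x using K(2) that by simp
  show thesis
  proof
    fix x y assume x: "x \<in> X" and y: "y \<in> X" and xy: "\<And>i. \<bar>i\<bar> \<le> Max (R ` K) \<Longrightarrow> x i = y i"
    obtain k where k: "k \<in> K" "x \<in> ?C k (R k)" using x cover by blast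
    have kX: "k \<in> X" using k(1) K(1) by blast
    have "y i = k i" if "\<bar>i\<bar> \<le> R k" for i
      using xy[of i] k(2) le[OF k(1)] that by auto
    then have "y \<in> ?C k (R k)" using y by blast
    then show "f x 0 = f y 0" using R[OF kX k(2)] R[OF kX, of y] by simp
  qed
qed

text \<open>Forward shifts follow by induction; a backward shift is the forward case applied to the
  translated point.\<close>

lemma shift_invariant_map:
  assumes inv: "\<And>x m. x \<in> X \<Longrightarrow> (\<lambda>n. x (n + m)) \<in> X"
    and comm: "\<And>x. x \<in> X \<Longrightarrow> f (shift x) = shift (f x)" and x: "x \<in> X"
  shows "f (\<lambda>n. x (n + m)) = (\<lambda>n. f x (n + m))"
proof -
  have pos: "f ((shift ^^ k) x) = (shift ^^ k) (f x)" if "x \<in> X" for x k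
  proof (induction k)
    case (Suc k)
    have "(shift ^^ k) x \<in> X" using inv that unfolding funpow_shift by blast
    then show ?case using comm Suc by simp
  qed simp
  show ?thesis
  proof (cases "m \<ge> 0")
    case True
    then show ?thesis using pos[OF x, of "nat m"] by (simp add: funpow_shift)
  next
    case False
    then have "f x = (\<lambda>n. f (\<lambda>n. x (n + m)) (n - m))"
      using pos[OF inv[OF x, of m], of "nat (- m)"] by (simp add: funpow_shift)
    then show ?thesis by (metis add_diff_cancel_right')
  qed
qed

section \<open>Substitutions with bijective columns\<close>

lemma sublist_map_upt_iff:
  "sublist (factor_at x i l) (map (\<lambda>k. y (int k)) [0..<N]) \<longleftrightarrow>
   (\<exists>d. d + l \<le> N \<and> (\<forall>k<l. x (i + int k) = y (int (d + k))))"
proof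
  assume "sublist (factor_at x i l) (map (\<lambda>k. y (int k)) [0..<N])"
  then obtain us vs where e: "map (\<lambda>k. y (int k)) [0..<N] = us @ factor_at x i l @ vs"
    unfolding sublist_def by blast
  have len: "N = length us + l + length vs"
    using arg_cong[OF e, of length] by (simp add: factor_at_def)
  have "x (i + int k) = y (int (length us + k))" if "k < l" for k
    using arg_cong[OF e, of "\<lambda>w. w ! (length us + k)"] that len
    by (simp add: factor_at_def nth_append)
  then show "\<exists>d. d + l \<le> N \<and> (\<forall>k<l. x (i + int k) = y (int (d + k)))"
    using len by (intro exI[of _ "length us"]) simp
next
  assume "\<exists>d. d + l \<le> N \<and> (\<forall>k<l. x (i + int k) = y (int (d + k)))"
  then obtain d where d: "d + l \<le> N" and eq: "\<forall>k<l. x (i + int k) = y (int (d + k))" by blast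
  let ?w = "map (\<lambda>k. y (int k)) [0..<N]"
  have "factor_at x i l = take l (drop d ?w)"
    using d eq by (intro nth_equalityI) (auto simp: factor_at_def)
  moreover have "?w = take d ?w @ take l (drop d ?w) @ drop l (drop d ?w)"
    by (metis append_take_drop_id)
  ultimately show "sublist (factor_at x i l) ?w"
    unfolding sublist_def by metis
qed

text \<open>Floor division by \<open>L\<close> fixes 0 and -1 and moves every other integer strictly
  closer to 0. Recursion along \<open>n div L\<close>, ending at these two positions, rests on
  this.\<close>

lemma abs_div_less:
  fixes n L :: int
  assumes "2 \<le> L" "n \<noteq> 0" "n \<noteq> -1"
  shows "\<bar>n div L\<bar> < \<bar>n\<bar>"
proof (cases "n > 0")
  case True
  then show ?thesis using assms by (simp add: int_div_less_self pos_imp_zdiv_nonneg_iff)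
next
  case False
  then have n: "n \<le> -2" using assms by linarith
  have "n = L * (n div L) + n mod L" by simp
  moreover have "0 \<le> n mod L" "n mod L < L" using assms by auto
  moreover have q: "n div L < 0" using n assms by (intro div_neg_pos_less0) auto
  \<comment> \<open>Otherwise \<open>n \<le> L * n + L - 1\<close>, that is,
    \<open>0 \<le> (L - 1) * (n + 1)\<close>, which fails for \<open>n \<le> -2\<close>.\<close>
  have "n < n div L"
  proof (rule ccontr)
    assume "\<not> n < n div L"
    then have "n div L \<le> n" by simp
    then have "L * (n div L) \<le> L * n" using assms by (simp add: mult_left_mono)
    moreover have "L * n + L - 1 < n"
    proof -
      have "(L - 1) * (n + 1) < 0" using n assms by (simp add: mult_pos_neg)
      then show ?thesis by (simp add: algebra_simps)
    qed
    moreover have "n = L * (n div L) + n mod L" "n mod L < L" using assms by auto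
    ultimately show False by linarith
  qed
  then show ?thesis using q by linarith
qed

lemma block_less:
  fixes j k M N :: int
  assumes "0 \<le> k" "k < M" "0 \<le> j" "j < N"
  shows "0 \<le> j * M + k" "j * M + k < N * M"
proof -
  show "0 \<le> j * M + k" using assms by simp
  have "(j + 1) * M \<le> N * M" using assms by (intro mult_right_mono) auto
  then show "j * M + k < N * M" using assms by (simp add: algebra_simps)
qed

text \<open>
  The pattern \<open>aaaab\<close> with \<open>a \<noteq> b\<close> marks the beginnings of the blocks: \<open>p_id\<close> puts it
  there, and \<open>p_ne\<close> prevents other occurrences. The conditions \<open>p 0 = id\<close> and
  \<open>p (L - 1) = id\<close> also make every two-letter seed the centre of a fixed point.
\<close>

locale bijective_substitution =
  fixes S :: "'a set" and L :: int and p :: "int \<Rightarrow> 'a \<Rightarrow> 'a"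
  assumes finite_S: "finite S" and S_ne: "S \<noteq> {}"
    and L_ge: "6 \<le> L" and L_even: "even L"
    and p_bij: "\<And>i. 0 \<le> i \<Longrightarrow> i < L \<Longrightarrow> bij_betw (p i) S S"
    and p_id: "\<And>i s. i \<in> {0, 1, 2, 3, L - 1} \<Longrightarrow> s \<in> S \<Longrightarrow> p i s = s"
    and p_ne: "\<And>i s. odd i \<Longrightarrow> 3 \<le> i \<Longrightarrow> i < L - 1 \<Longrightarrow> s \<in> S \<Longrightarrow> p (i + 1) s \<noteq> p i s"
    and p_onto: "\<And>s t. s \<in> S \<Longrightarrow> t \<in> S \<Longrightarrow> \<exists>i\<ge>0. i < L \<and> p i s = t"
begin

section \<open>Powers of the substitution and their columns\<close>

definition \<tau> :: "'a \<Rightarrow> 'a list" where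
  "\<tau> a = map (\<lambda>i. p (int i) a) [0..<nat L]"

text \<open>The substitution acting on bi-infinite sequences, with the image of the letter at
  \<open>j\<close> placed on the positions from \<open>j * L\<close> to
  \<open>j * L + L - 1\<close>. Floor division makes one formula serve both signs.\<close>

definition T :: "(int \<Rightarrow> 'a) \<Rightarrow> int \<Rightarrow> 'a" where
  "T x n = p (n mod L) (x (n div L))"

text \<open>The \<open>k\<close>-th column of the \<open>n\<close>-th power, for \<open>0 \<le> k < L ^ n\<close>.\<close>

abbreviation P :: "nat \<Rightarrow> int \<Rightarrow> 'a \<Rightarrow> 'a" where
  "P n k a \<equiv> (T ^^ n) (\<lambda>_. a) k"

abbreviation X :: "(int \<Rightarrow> 'a) set" where
  "X \<equiv> subst_shift S \<tau>"

lemma T_funpow_Suc: "(T ^^ Suc n) x k = p (k mod L) ((T ^^ n) x (k div L))"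
  by (simp add: T_def)

lemma L_pos: "0 < L" using L_ge by simp

lemma p_in: "0 \<le> i \<Longrightarrow> i < L \<Longrightarrow> s \<in> S \<Longrightarrow> p i s \<in> S"
  using p_bij bij_betwE by blast

lemma p_inj: "0 \<le> i \<Longrightarrow> i < L \<Longrightarrow> s \<in> S \<Longrightarrow> t \<in> S \<Longrightarrow> p i s = p i t \<Longrightarrow> s = t"
  using p_bij bij_betw_imp_inj_on inj_onD by metis

lemma T_in: "(\<And>n. x n \<in> S) \<Longrightarrow> T x n \<in> S"
  using L_pos by (simp add: T_def p_in)

lemma T_funpow_in: "(\<And>m. x m \<in> S) \<Longrightarrow> (T ^^ n) x k \<in> S"
  by (induction n arbitrary: k) (auto intro: T_in)

text \<open>A column of a power is a composition of columns, one for each of the \<open>n\<close>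
  lowest base-\<open>L\<close> digits of \<open>k\<close>.\<close>

lemma P_inj: "s \<in> S \<Longrightarrow> t \<in> S \<Longrightarrow> P n k s = P n k t \<Longrightarrow> s = t"
proof (induction n arbitrary: k)
  case (Suc n)
  have "P n (k div L) s = P n (k div L) t"
  proof (rule p_inj)
    show "p (k mod L) (P n (k div L) s) = p (k mod L) (P n (k div L) t)"
      using Suc.prems(3) by (simp only: T_funpow_Suc)
  qed (use Suc.prems L_pos in \<open>auto intro: T_funpow_in\<close>)
  then show ?case using Suc by blast
qed simp

text \<open>The power is again a substitution of constant length, now \<open>L ^ n\<close>, with
  columns \<open>P n k\<close>.\<close>

lemma T_funpow: "(T ^^ n) x m = P n (m mod L ^ n) (x (m div L ^ n))"
proof (induction n arbitrary: m)
  case (Suc n)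
  have "m div L div L ^ n = m div L ^ Suc n"
    using L_pos by (simp add: zdiv_zmult2_eq)
  moreover have "(m mod L ^ Suc n) div L = (m div L) mod L ^ n"
    using L_pos by (simp add: zmod_zmult2_eq div_add1_eq)
  moreover have "(m mod L ^ Suc n) mod L = m mod L"
    by (simp add: mod_mod_cancel)
  ultimately show ?case
    by (simp only: T_funpow_Suc Suc[of "m div L"])
qed simp

lemma T_funpow_block:
  assumes "0 \<le> k" "k < L ^ n"
  shows "(T ^^ n) x (j * L ^ n + k) = P n k (x j)"
  using assms L_pos unfolding T_funpow[of n x] by simp

text \<open>Splits off the highest base-\<open>L\<close> digit, where \<open>T_funpow_Suc\<close>
  splits off the lowest: a block of level \<open>n + 1\<close> is a row of \<open>L\<close> blocks
  of level \<open>n\<close>.\<close>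

lemma P_Suc_block:
  assumes "0 \<le> k" "k < L ^ n" "0 \<le> j" "j < L"
  shows "P (Suc n) (j * L ^ n + k) a = P n k (p j a)"
  using assms unfolding funpow_Suc_right o_apply
  by (subst T_funpow_block) (simp_all add: T_def)

lemma subst_ext_map_upt:
  "subst_ext \<tau> (map (\<lambda>k. x (int k)) [0..<m]) = map (\<lambda>k. T x (int k)) [0..<m * nat L]"
proof (induction m)
  case (Suc m)
  have "[0..<Suc m * nat L] = [0..<m * nat L] @ map (\<lambda>i. i + m * nat L) [0..<nat L]"
    by (metis add.commute map_add_upt mult_Suc upt_add_eq_append zero_le)
  moreover have "T x (int (i + m * nat L)) = p (int i) (x (int m))" if "i < nat L" for i
    using that L_pos unfolding T_def by simp
  then have "map ((\<lambda>k. T x (int k)) \<circ> (\<lambda>i. i + m * nat L)) [0..<nat L] = \<tau> (x (int m))"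
    unfolding \<tau>_def by (intro map_cong) auto
  ultimately show ?case
    using Suc by (simp add: subst_ext_def del: mult_Suc)
qed (simp add: subst_ext_def)

text \<open>Links the words in the definition of the subshift with the sequences \<open>P n\<close>,
  so that factors become windows of functions on the integers.\<close>

lemma subst_ext_funpow:
  "(subst_ext \<tau> ^^ n) [a] = map (\<lambda>k. P n (int k) a) [0..<nat L ^ n]"
proof (induction n)
  case (Suc n)
  show ?case
    using Suc subst_ext_map_upt[of "\<lambda>k. P n k a" "nat L ^ n"] by (simp add: mult.commute)
qed simp

lemma substitution_\<tau>: "substitution S \<tau>"
proof -
  have "\<tau> \<in> S \<rightarrow> lists S"
    by (auto simp: \<tau>_def p_in)
  moreover have "filterlim (\<lambda>n. nat L ^ n) at_top sequentially"
    by (rule filterlim_at_top_mono[OF filterlim_ident])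
      (use L_ge in \<open>auto intro!: always_eventually less_imp_le power_gt_expt\<close>)
  ultimately show ?thesis
    unfolding substitution_def using finite_S S_ne by (simp add: subst_ext_funpow)
qed

section \<open>Points of the subshift described by central windows\<close>

text \<open>Here \<open>e\<close> is the place of the origin inside the word, and the half-open
  window from \<open>-r\<close> to \<open>r\<close> fits into the word around it.\<close>

lemma X_iff:
  "x \<in> X \<longleftrightarrow> (\<forall>n. x n \<in> S) \<and>
    (\<forall>r. \<exists>n a e. a \<in> S \<and> 0 \<le> e - r \<and> e + r \<le> L ^ n \<and> (\<forall>k. -r \<le> k \<and> k < r \<longrightarrow> x k = P n (k + e) a))"
    (is "_ \<longleftrightarrow> _ \<and> (\<forall>r. ?W r)")
proof (intro iffI conjI allI)
  assume x: "x \<in> X"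
  then show "x n \<in> S" for n unfolding subst_shift_def by auto
  fix r :: int
  obtain n a where a: "a \<in> S" "sublist (factor_at x (-r) (nat (2 * r))) ((subst_ext \<tau> ^^ n) [a])"
    using x unfolding subst_shift_def by blast
  then obtain d where d: "d + nat (2 * r) \<le> nat L ^ n"
      and eq: "\<And>k. k < nat (2 * r) \<Longrightarrow> x (-r + int k) = P n (int (d + k)) a"
    unfolding subst_ext_funpow sublist_map_upt_iff by blast
  have d': "int d + int (nat (2 * r)) \<le> L ^ n"
    using d L_pos by (metis int_nat_eq of_nat_add of_nat_le_iff of_nat_power order_less_imp_le)
  then have "int d + 2 * r \<le> L ^ n" by linarith
  moreover have "x k = P n (k + (int d + r)) a" if "-r \<le> k \<and> k < r" for k
    using eq[of "nat (k + r)"] that by (simp add: algebra_simps)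
  ultimately show "?W r"
    using a by (intro exI[of _ n] exI[of _ a] exI[of _ "int d + r"]) (auto simp: algebra_simps)
next
  assume x: "(\<forall>n. x n \<in> S) \<and> (\<forall>r. ?W r)"
  have "\<exists>n\<ge>1. \<exists>a\<in>S. sublist (factor_at x i l) ((subst_ext \<tau> ^^ n) [a])" for i l
  proof -
    obtain n a e where a: "a \<in> S" and e: "0 \<le> e - (\<bar>i\<bar> + int l)" "e + (\<bar>i\<bar> + int l) \<le> L ^ n"
        and eq: "\<And>k. -(\<bar>i\<bar> + int l) \<le> k \<Longrightarrow> k < \<bar>i\<bar> + int l \<Longrightarrow> x k = P n (k + e) a"
      using x by blast
    \<comment> \<open>The definition of the subshift asks for a power of at least 1. Writing
      \<open>a\<close> as a column of some \<open>b\<close> moves the window up one level.\<close>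
    obtain b j where b: "b \<in> S" "0 \<le> j" "j < L" "p j b = a" using p_onto a by blast
    define d where "d = nat (j * L ^ n + e + i)"
    have pos: "0 \<le> j * L ^ n" using b L_pos by simp
    have d: "int d = j * L ^ n + (e + i)" using e pos by (simp add: d_def)
    have "(j + 1) * L ^ n \<le> L * L ^ n" using b L_pos by (intro mult_right_mono) auto
    then have "int (d + l) \<le> L ^ Suc n" using e d by (simp add: algebra_simps)
    also have "\<dots> = int (nat L ^ Suc n)" using L_pos by simp
    finally have "d + l \<le> nat L ^ Suc n" by linarith
    moreover have "x (i + int k) = P (Suc n) (int (d + k)) b" if "k < l" for k
    proof -
      have "x (i + int k) = P n (e + i + int k) a"
        using eq[of "i + int k"] that by (simp add: algebra_simps)
      also have "\<dots> = P (Suc n) (j * L ^ n + (e + i + int k)) b"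
        using P_Suc_block[of "e + i + int k" n j b] b e that by auto
      finally show ?thesis using d by (simp add: algebra_simps)
    qed
    ultimately have "sublist (factor_at x i l) ((subst_ext \<tau> ^^ Suc n) [b])"
      unfolding subst_ext_funpow sublist_map_upt_iff by blast
    then show ?thesis using b by (intro exI[of _ "Suc n"]) auto
  qed
  then show "x \<in> X" unfolding subst_shift_def using x by blast
qed

lemma X_in: "x \<in> X \<Longrightarrow> x n \<in> S"
  using X_iff by blast

lemma X_subset: "X \<subseteq> UNIV \<rightarrow> S"
  using X_in by blast

lemma X_window:
  "x \<in> X \<Longrightarrow> \<exists>n a e. a \<in> S \<and> 0 \<le> e - r \<and> e + r \<le> L ^ n \<and>
    (\<forall>k. -r \<le> k \<and> k < r \<longrightarrow> x k = P n (k + e) a)"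
  unfolding X_iff by blast

text \<open>A positive level leaves one application of the substitution to undo; it is obtained by
  embedding the word into a block one level up.\<close>

lemma X_window_Suc:
  assumes "x \<in> X"
  shows "\<exists>n a e. a \<in> S \<and> 0 \<le> e - r \<and> e + r \<le> L ^ Suc n \<and>
    (\<forall>k. -r \<le> k \<and> k < r \<longrightarrow> x k = P (Suc n) (k + e) a)"
proof -
  obtain n a e where a: "a \<in> S" and e: "0 \<le> e - r" "e + r \<le> L ^ n"
      and eq: "\<forall>k. -r \<le> k \<and> k < r \<longrightarrow> x k = P n (k + e) a"
    using X_window[OF assms, of r] by (elim exE conjE) (rule that)
  obtain b j where b: "b \<in> S" "0 \<le> j" "j < L" "p j b = a" using p_onto a by blast
  show ?thesis
  proof (intro exI conjI allI impI)
    show "b \<in> S" by fact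
    have "0 \<le> j * L ^ n" using b L_pos by simp
    then show "0 \<le> (j * L ^ n + e) - r" using e by simp
    have "(j + 1) * L ^ n \<le> L * L ^ n" using b L_pos by (intro mult_right_mono) auto
    then show "(j * L ^ n + e) + r \<le> L ^ Suc n" using e by (simp add: algebra_simps)
    fix k assume k: "-r \<le> k \<and> k < r"
    then have "x k = P n (k + e) a" using eq by blast
    also have "\<dots> = P (Suc n) (j * L ^ n + (k + e)) b"
      using P_Suc_block[of "k + e" n j b] k b e by simp
    finally show "x k = P (Suc n) (k + (j * L ^ n + e)) b" by (simp only: ac_simps)
  qed
qed

lemma X_shift: "x \<in> X \<Longrightarrow> (\<lambda>n. x (n + m)) \<in> X"
proof -
  assume x: "x \<in> X"
  have "factor_at (\<lambda>n. x (n + m)) i l = factor_at x (i + m) l" for i l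
    by (simp add: factor_at_def algebra_simps)
  then show ?thesis using x unfolding subst_shift_def by auto
qed

lemma X_limit:
  assumes z: "\<And>n. z n \<in> S" and approx: "\<And>r. \<exists>y\<in>X. \<forall>i. \<bar>i\<bar> \<le> r \<longrightarrow> y i = z i"
  shows "z \<in> X"
  unfolding X_iff
proof (intro conjI allI z)
  fix r
  obtain y where y: "y \<in> X" "\<forall>i. \<bar>i\<bar> \<le> r \<longrightarrow> y i = z i" using approx by blast
  obtain n a e where a: "a \<in> S" and e: "0 \<le> e - r" "e + r \<le> L ^ n"
      and eq: "\<forall>k. -r \<le> k \<and> k < r \<longrightarrow> y k = P n (k + e) a"
    using X_window[OF y(1), of r] by (elim exE conjE) (rule that)
  have "z k = P n (k + e) a" if "-r \<le> k \<and> k < r" for k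
    using eq y(2)[rule_format, of k] that by force
  then show "\<exists>n a e. a \<in> S \<and> 0 \<le> e - r \<and> e + r \<le> L ^ n \<and>
      (\<forall>k. -r \<le> k \<and> k < r \<longrightarrow> z k = P n (k + e) a)"
    using a e by (intro exI[of _ n] exI[of _ a] exI[of _ e]) simp
qed

section \<open>Desubstitution\<close>

text \<open>Each finite window can be cut into blocks at some phase. There are finitely many phases,
  so one of them works for all windows, and the first letters of its blocks form the
  preimage.\<close>

lemma desubst:
  assumes x: "x \<in> X"
  shows "\<exists>c y. 0 \<le> c \<and> c < L \<and> y \<in> X \<and> (\<forall>n. x n = T y (n - c))"
proof -
  \<comment> \<open>\<open>Q r c\<close> holds if the window of radius \<open>r\<close> comes from a
    word whose blocks begin at the positions congruent to \<open>c\<close> modulo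
    \<open>L\<close>.\<close>
  define Q where "Q r c \<longleftrightarrow> (\<exists>n a e. a \<in> S \<and> 0 \<le> e - r \<and> e + r \<le> L ^ Suc n \<and>
     (\<forall>k. -r \<le> k \<and> k < r \<longrightarrow> x k = P (Suc n) (k + e) a) \<and> L dvd c + e)" for r c
  have Q_mono: "Q r c" if Q: "Q r' c" and le: "r \<le> r'" for r r' c
  proof -
    obtain n a e where "a \<in> S" "0 \<le> e - r'" "e + r' \<le> L ^ Suc n"
      "\<forall>k. -r' \<le> k \<and> k < r' \<longrightarrow> x k = P (Suc n) (k + e) a" "L dvd c + e"
      using Q unfolding Q_def by (elim exE conjE) (rule that)
    then show ?thesis
      unfolding Q_def using le by (intro exI[of _ n] exI[of _ a] exI[of _ e]) simp
  qed
  have Q_ex: "\<exists>c\<in>{0..<L}. Q r c" for r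
  proof -
    obtain n a e where "a \<in> S" "0 \<le> e - r" "e + r \<le> L ^ Suc n"
      "\<forall>k. -r \<le> k \<and> k < r \<longrightarrow> x k = P (Suc n) (k + e) a"
      using X_window_Suc[OF x, of r] by (elim exE conjE) (rule that)
    moreover have "L dvd (- e) mod L + e"
      by (metis add.left_inverse dvd_0_right mod_add_left_eq mod_0_imp_dvd mod_0)
    ultimately have "Q r ((- e) mod L)"
      unfolding Q_def by (intro exI[of _ n] exI[of _ a] exI[of _ e]) simp
    then show ?thesis using L_pos by (intro bexI[of _ "(- e) mod L"]) auto
  qed
  \<comment> \<open>Were every phase to fail at some radius, all would fail at the largest of these
    radii, since \<open>Q\<close> is antitone in the radius.\<close>
  have "\<exists>c\<in>{0..<L}. \<forall>r. Q r c"
  proof (rule ccontr)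
    assume "\<not> ?thesis"
    then have "\<forall>c\<in>{0..<L}. \<exists>r. \<not> Q r c" by blast
    from bchoice[OF this] obtain R where R: "\<And>c. c \<in> {0..<L} \<Longrightarrow> \<not> Q (R c) c" by blast
    obtain c where c: "c \<in> {0..<L}" "Q (Max (R ` {0..<L})) c" using Q_ex by blast
    then have "Q (R c) c" by (intro Q_mono[OF c(2)] Max_ge) auto
    then show False using R c(1) by blast
  qed
  then obtain c where c: "0 \<le> c" "c < L" and Q: "\<And>r. Q r c" by auto
  have window: "\<exists>n a t. a \<in> S \<and> 0 \<le> t - r \<and> t + r \<le> L ^ n \<and>
     (\<forall>k. -(r * L) \<le> k \<and> k < r * L \<longrightarrow> x k = P (Suc n) (k - c + L * t) a)" if r: "0 \<le> r" for r
  proof -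
    \<comment> \<open>The extra block of margin absorbs the phase \<open>c\<close>, so that
      \<open>t + r\<close> stays within the shorter word.\<close>
    obtain n a e where a: "a \<in> S" and e: "0 \<le> e - (r + 1) * L" "e + (r + 1) * L \<le> L ^ Suc n"
      and eq: "\<forall>k. -((r + 1) * L) \<le> k \<and> k < (r + 1) * L \<longrightarrow> x k = P (Suc n) (k + e) a"
      and "L dvd c + e"
      using Q[of "(r + 1) * L"] unfolding Q_def by (elim exE conjE) (rule that)
    then obtain t where t: "c + e = L * t" by (elim dvdE)
    have te: "e = L * t - c" using t by simp
    have e': "r * L + L \<le> e" "e + (r * L + L) \<le> L * L ^ n"
      using e by (simp_all add: distrib_right)
    have "L * r \<le> L * t" using e' c t L_pos unfolding mult.commute[of r L] by linarith
    then have "0 \<le> t - r" using L_pos by simp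
    moreover have "L * (t + r) \<le> L * L ^ n" 
      using e' c t L_pos unfolding mult.commute[of r L] distrib_left by linarith
    then have "t + r \<le> L ^ n" using L_pos by simp
    moreover have "x k = P (Suc n) (k - c + L * t) a" if "-(r * L) \<le> k \<and> k < r * L" for k
    proof -
      have "-((r + 1) * L) \<le> k \<and> k < (r + 1) * L" using that L_pos by (simp add: algebra_simps)
      then have "x k = P (Suc n) (k + e) a" using eq by blast
      moreover have "k + e = k - c + L * t" using te by simp
      ultimately show ?thesis by (simp only:)
    qed
    ultimately show ?thesis using a by (intro exI[of _ n] exI[of _ a] exI[of _ t]) simp
  qed
  \<comment> \<open>Column 0 is the identity, so the first letter of a block is the letter that
    produced it.\<close>
  define y where "y j = x (c + j * L)" for j
  have y: "y j = P n (j + t) a"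
    if "a \<in> S" "\<forall>k. -(r * L) \<le> k \<and> k < r * L \<longrightarrow> x k = P (Suc n) (k - c + L * t) a" "-r \<le> j" "j < r"
    for j r n a t
  proof -
    have "-(r * L) \<le> j * L" using mult_right_mono[of "-r" j L] that L_pos by simp
    moreover have "(j + 1) * L \<le> r * L" using that L_pos by (intro mult_right_mono) auto
    ultimately have "-(r * L) \<le> c + j * L \<and> c + j * L < r * L"
      using c by (simp add: algebra_simps)
    then have "y j = P (Suc n) ((c + j * L) - c + L * t) a"
      unfolding y_def using that(2) by blast
    also have "\<dots> = P (Suc n) (L * (j + t)) a" by (simp add: algebra_simps)
    also have "\<dots> = p 0 (P n (j + t) a)" using L_pos by (simp only: T_funpow_Suc) simp
    also have "\<dots> = P n (j + t) a" using that(1) by (intro p_id T_funpow_in) auto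
    finally show ?thesis .
  qed
  have "y \<in> X"
    unfolding X_iff
  proof (intro conjI allI)
    show "y n \<in> S" for n using X_in[OF x] by (simp add: y_def)
    fix r :: int
    define r' where "r' = max 0 r"
    have "0 \<le> r'" by (simp add: r'_def)
    obtain n a t where a: "a \<in> S" and t: "0 \<le> t - r'" "t + r' \<le> L ^ n"
       and eq: "\<forall>k. -(r' * L) \<le> k \<and> k < r' * L \<longrightarrow> x k = P (Suc n) (k - c + L * t) a"
      using window[OF \<open>0 \<le> r'\<close>] by (elim exE conjE) (rule that)
    have "\<forall>j. -r \<le> j \<and> j < r \<longrightarrow> y j = P n (j + t) a"
      using y[OF a eq] unfolding r'_def by auto
    then show "\<exists>n a e. a \<in> S \<and> 0 \<le> e - r \<and> e + r \<le> L ^ n \<and> (\<forall>k. -r \<le> k \<and> k < r \<longrightarrow> y k = P n (k + e) a)"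
      using a t unfolding r'_def by (intro exI[of _ n] exI[of _ a] exI[of _ t]) auto
  qed
  moreover have "x k = T y (k - c)" for k
  proof -
    define q where "q = (k - c) div L"
    \<comment> \<open>Large enough for both the position \<open>k\<close> and the index
      \<open>q\<close> of its block.\<close>
    define r where "r = \<bar>k\<bar> + \<bar>q\<bar> + 1"
    have "0 \<le> r" by (simp add: r_def)
    obtain n a t where a: "a \<in> S"
       and eq: "\<forall>k. -(r * L) \<le> k \<and> k < r * L \<longrightarrow> x k = P (Suc n) (k - c + L * t) a"
      using window[OF \<open>0 \<le> r\<close>] by (elim exE conjE) (rule that)
    have "r * 1 \<le> r * L" using L_pos unfolding r_def by (intro mult_left_mono) auto
    moreover have "\<bar>k\<bar> < r" by (simp add: r_def)
    ultimately have "-(r * L) \<le> k \<and> k < r * L" by linarith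
    then have "x k = P (Suc n) (k - c + L * t) a" using eq by blast
    also have "\<dots> = p ((k - c) mod L) (P n (q + t) a)"
      using L_pos unfolding T_funpow_Suc q_def by (simp add: add.commute)
    also have "P n (q + t) a = y q"
      using y[OF a eq, of q] unfolding r_def by simp
    finally show ?thesis unfolding T_def q_def .
  qed
  ultimately show ?thesis using c by blast
qed

text \<open>A shift by \<open>c'\<close> before an application of \<open>T\<close> is a shift by
  \<open>c' * L\<close> after it, so the phases accumulate.\<close>

lemma desubst_funpow:
  "x \<in> X \<Longrightarrow> \<exists>c y. y \<in> X \<and> (\<forall>n. x n = (T ^^ k) y (n - c))"
proof (induction k arbitrary: x)
  case 0
  then show ?case by (intro exI[of _ 0] exI[of _ x]) simp
next
  case (Suc k)
  obtain c y where y: "y \<in> X" and xy: "\<And>n. x n = T y (n - c)"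
    using desubst[OF Suc.prems] by blast
  obtain c' z where z: "z \<in> X" and yz: "\<And>n. y n = (T ^^ k) z (n - c')"
    using Suc.IH[OF y] by blast
  have "x n = (T ^^ Suc k) z (n - (c + c' * L))" for n
  proof -
    have e: "n - (c + c' * L) = (n - c) + (- c') * L" by simp
    have "(n - (c + c' * L)) mod L = (n - c) mod L"
      unfolding e by (rule mod_mult_self1)
    moreover have "(n - (c + c' * L)) div L = (n - c) div L - c'"
      using L_pos unfolding e by (subst div_mult_self1) auto
    ultimately show ?thesis unfolding xy T_funpow_Suc T_def yz by simp
  qed
  then show ?case using z by blast
qed

section \<open>Minimality\<close>

text \<open>By \<open>p_onto\<close> every letter occurs in the image of every letter, so any block
  of level \<open>n + 1\<close> contains all blocks of level \<open>n\<close>. A single block of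
  \<open>x\<close> thus already shows the window of \<open>z\<close>.\<close>

lemma uniform_recurrence:
  assumes x: "x \<in> X" and z: "z \<in> X"
  shows "\<exists>m. \<forall>k. \<bar>k\<bar> \<le> r \<longrightarrow> x (k + m) = z k"
proof -
  \<comment> \<open>Windows are half-open, so radius \<open>r + 1\<close> is taken to include the
    position \<open>r\<close>.\<close>
  obtain n a e where a: "a \<in> S" and e: "0 \<le> e - (r + 1)" "e + (r + 1) \<le> L ^ n"
      and eq: "\<forall>k. -(r + 1) \<le> k \<and> k < r + 1 \<longrightarrow> z k = P n (k + e) a"
    using X_window[OF z, of "r + 1"] by (elim exE conjE) (rule that)
  obtain c y where y: "y \<in> X" and xy: "\<And>k. x k = (T ^^ Suc n) y (k - c)"
    using desubst_funpow[OF x] by blast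
  obtain j where j: "0 \<le> j" "j < L" "p j (y 0) = a" using p_onto X_in[OF y] a by blast
  have "x (k + (c + j * L ^ n + e)) = z k" if "\<bar>k\<bar> \<le> r" for k
  proof -
    have k: "0 \<le> k + e" "k + e < L ^ n" using that e by auto
    have "x (k + (c + j * L ^ n + e)) = (T ^^ Suc n) y (0 * L ^ Suc n + (j * L ^ n + (k + e)))"
      unfolding xy by (simp only: algebra_simps) simp
    also have "\<dots> = P (Suc n) (j * L ^ n + (k + e)) (y 0)"
      using block_less[OF k j(1,2)] by (intro T_funpow_block) simp_all
    also have "\<dots> = P n (k + e) a" using P_Suc_block[OF k j(1,2)] j(3) by simp
    also have "\<dots> = z k"
      using eq[rule_format, of k] that by (simp add: abs_le_iff)
    finally show ?thesis .
  qed
  then show ?thesis by blast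
qed

lemma minimal_X: "minimal_shift S X"
  unfolding minimal_shift_def
proof
  fix x assume x: "x \<in> X"
  have sub: "shift_orbit x \<subseteq> X" using X_shift[OF x] unfolding shift_orbit_def by auto
  show "shift_topology S X closure_of shift_orbit x = X"
  proof
    show "shift_topology S X closure_of shift_orbit x \<subseteq> X"
      using closure_of_subset_topspace topspace_shift_topology[OF X_subset] by metis
    show "X \<subseteq> shift_topology S X closure_of shift_orbit x"
    proof
      fix z assume z: "z \<in> X"
      have "\<exists>y\<in>shift_orbit x. y \<in> U" if U: "z \<in> U" "openin (shift_topology S X) U" for U
      proof -
        obtain r where r: "\<And>y. y \<in> X \<Longrightarrow> (\<And>i. \<bar>i\<bar> \<le> r \<Longrightarrow> y i = z i) \<Longrightarrow> y \<in> U"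
          using U unfolding openin_shift_topology[OF X_subset] by blast
        obtain m where "\<And>k. \<bar>k\<bar> \<le> r \<Longrightarrow> x (k + m) = z k"
          using uniform_recurrence[OF x z] by blast
        then have "(\<lambda>n. x (n + m)) \<in> U" using r X_shift[OF x] by blast
        then show ?thesis unfolding shift_orbit_def by blast
      qed
      then show "z \<in> shift_topology S X closure_of shift_orbit x"
        using z unfolding in_closure_of topspace_shift_topology[OF X_subset] by blast
    qed
  qed
qed

section \<open>Recognizability by markers, and aperiodicity\<close>

lemma T_at:
  assumes "0 \<le> k" "k < L"
  shows "T y (q * L + k) = p k (y q)"
  using assms by (simp add: T_def)

lemma marker_iff:
  assumes y: "\<And>n. y n \<in> S"
  shows "T y i = T y (i + 1) \<and> T y (i + 1) = T y (i + 2) \<and> T y (i + 2) = T y (i + 3) \<and>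
    T y (i + 3) \<noteq> T y (i + 4) \<longleftrightarrow> L dvd i" (is "?M \<longleftrightarrow> _")
proof -
  define q t where "q = i div L" and "t = i mod L"
  have i: "i = q * L + t" by (simp add: q_def t_def)
  have t: "0 \<le> t" "t < L" using L_pos by (simp_all add: t_def)
  have at: "T y (i + d) = p (t + d) (y q)" if "0 \<le> t + d" "t + d < L" for d
    using T_at[OF that, of y q] by (simp add: i add.assoc)
  have at': "T y (i + d) = y (q + 1)" if "t + d \<in> {L, L + 1, L + 2, L + 3}" for d
  proof -
    have "T y ((q + 1) * L + (t + d - L)) = p (t + d - L) (y (q + 1))"
      using that L_ge by (intro T_at) auto
    also have "\<dots> = y (q + 1)" using that y by (intro p_id) auto
    finally show ?thesis by (simp add: i algebra_simps)
  qed
  have odd_ne: "T y (i + d) \<noteq> T y (i + e)"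
    if "odd (t + d)" "3 \<le> t + d" "t + d < L - 1" "e = d + 1" for d e
    using p_ne[of "t + d" "y q"] that at[of d] at[of e] y by (simp add: add.assoc)
  have "L dvd i \<longleftrightarrow> t = 0" by (simp add: t_def dvd_eq_mod_eq_0)
  moreover have "?M" if "t = 0"
  proof -
    have "T y (i + d) = y q" if "d \<in> {0, 1, 2, 3}" for d
      using at[of d] p_id[of d "y q"] y that \<open>t = 0\<close> L_ge by auto
    from this[of 0] this[of 1] this[of 2] this[of 3]
    have "T y i = y q" "T y (i + 1) = y q" "T y (i + 2) = y q" "T y (i + 3) = y q"
      by simp_all
    moreover have "T y (i + 3) \<noteq> T y (i + 4)"
      by (rule odd_ne) (use \<open>t = 0\<close> L_ge in simp_all)
    ultimately show ?thesis by (simp only: simp_thms)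
  qed
  moreover have "\<not> ?M" if "t \<noteq> 0"
  proof
    assume M: ?M
    \<comment> \<open>If \<open>t \<le> L - 3\<close>, one of the first three positions has an odd
      index in the block, at least 3 and below \<open>L - 1\<close>, and \<open>p_ne\<close> breaks
      the run of equal letters there. Otherwise the last two positions lie in the constant beginning
      of the next block, so the final letter does not change.\<close>
    consider "t + 3 < L" | "t = L - 3" | "t = L - 2" | "t = L - 1" using t by linarith
    then show False
    proof cases
      case 1
      show False
      proof (cases "odd (t + 1)")
        case True
        then have "3 \<le> t + 1" using t that by presburger
        then have "T y (i + 1) \<noteq> T y (i + 2)" using True 1 by (intro odd_ne) simp_all
        then show False using M by blast
      next
        case False
        then have "T y (i + 2) \<noteq> T y (i + 3)" using t that 1 L_even by (intro odd_ne) presburger+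
        then show False using M by blast
      qed
    next
      case 2
      then have "T y (i + 0) \<noteq> T y (i + 1)" using L_even L_ge by (intro odd_ne) simp_all
      then show False using M by simp
    next
      case 3
      then have "T y (i + 3) = T y (i + 4)" using at'[of 3] at'[of 4] by simp
      then show False using M by blast
    next
      case 4
      then have "T y (i + 3) = T y (i + 4)" using at'[of 3] at'[of 4] by simp
      then show False using M by blast
    qed
  qed
  ultimately show ?thesis by blast
qed

text \<open>The phase of a point is visible in every left tail, as markers recur there.\<close>

lemma phase_unique:
  assumes y: "\<And>n. y n \<in> S" "\<And>n. y' n \<in> S"
    and c: "0 \<le> c" "c < L" "0 \<le> c'" "c' < L"
    and eq: "\<And>n. n < m \<Longrightarrow> T y (n - c) = T y' (n - c')"
  shows "c = c'"
proof -
  \<comment> \<open>A marker occupies five positions. The last block of \<open>y\<close> that starts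
    at or before \<open>m - 5\<close> has its whole marker to the left of \<open>m\<close>.\<close>
  define q where "q = m - 5"
  define i where "i = c + L * ((q - c) div L)"
  have "L * ((q - c) div L) \<le> q - c"
    using mult_div_mod_eq[of L "q - c"] pos_mod_sign[of L "q - c"] L_pos by linarith
  then have "i + 4 < m" by (simp add: i_def q_def)
  then have e: "T y (i - c + d) = T y' (i - c' + d)" if "d \<le> 4" for d
    using eq[of "i + d"] that by (simp add: algebra_simps)
  have "L dvd i - c" by (simp add: i_def)
  then have "L dvd i - c'"
    using marker_iff[of y "i - c"] marker_iff[of y' "i - c'"] y e[of 0] e[of 1] e[of 2] e[of 3] e[of 4]
    by simp
  then have "L dvd c - c'"
    using \<open>L dvd i - c\<close> by (metis dvd_diff diff_diff_eq2 diff_add_cancel add_diff_cancel_left)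
  then have "c mod L = c' mod L" by (simp add: mod_eq_dvd_iff)
  then show ?thesis using c by simp
qed

text \<open>An injective letter map preserves which letters are equal, so markers move to markers
  and \<open>L\<close> divides \<open>m\<close>. The desubstituted point satisfies the same relation
  with \<open>m div L\<close>, and descent leaves only 0. This separates shifts from letter
  maps.\<close>

lemma aperiodic:
  assumes "x \<in> X" and "inj_on \<phi> S" and "\<phi> \<in> S \<rightarrow> S" and "\<And>n. x (n + m) = \<phi> (x n)"
  shows "m = 0"
  using assms(1,4)
proof (induction "nat \<bar>m\<bar>" arbitrary: m x rule: less_induct)
  case less
  obtain c y where c: "0 \<le> c" "c < L" and y: "y \<in> X" and xy: "\<And>n. x n = T y (n - c)"
    using desubst[OF less.prems(1)] by blast
  note yS = X_in[OF y]
  have inj: "x i = x j \<longleftrightarrow> x (i + m) = x (j + m)" for i j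
    using less.prems(2) assms(2) X_in[OF less.prems(1)] by (auto dest: inj_onD)
  have e: "T y i = T y j \<longleftrightarrow> T y (i + m) = T y (j + m)" for i j
    using inj[of "i + c" "j + c"] unfolding xy by (simp add: algebra_simps)
  have "L dvd m"
    using marker_iff[of y 0] marker_iff[of y m] yS e[of 0 1] e[of 1 2] e[of 2 3] e[of 3 4]
    by (simp add: add.commute)
  then obtain k where k: "m = L * k" by auto
  have "y (j + k) = \<phi> (y j)" for j
  proof -
    have y_at: "y j = x (c + j * L)" for j
      using T_at[of 0 y j] p_id[of 0 "y j"] yS L_pos by (simp add: xy)
    show ?thesis
      using less.prems(2)[of "c + j * L"] unfolding y_at k by (simp add: algebra_simps)
  qed
  then have "k = 0" if "nat \<bar>k\<bar> < nat \<bar>m\<bar>"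
    using less.hyps[OF that y] by blast
  moreover have "nat \<bar>k\<bar> < nat \<bar>m\<bar>" if "m \<noteq> 0"
    using that L_ge unfolding k by (simp add: abs_mult)
  ultimately show ?case using k by (metis mult_zero_right)
qed

section \<open>Fixed points grown from two-letter seeds\<close>

text \<open>The fixed point of \<open>T\<close> with \<open>a\<close> at -1 and \<open>b\<close> at
  0, the two positions whose block index is the position itself. All other letters follow from the
  equation \<open>T x = x\<close>.\<close>

function seed_point :: "'a \<Rightarrow> 'a \<Rightarrow> int \<Rightarrow> 'a" where
  "seed_point a b n =
     (if n = 0 then b else if n = -1 then a else p (n mod L) (seed_point a b (n div L)))"
  by pat_completeness auto
termination
  by (relation "measure (\<lambda>(a, b, n). nat \<bar>n\<bar>)") (use abs_div_less[of L] L_ge in auto)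

declare seed_point.simps [simp del]

lemma seed_point_0: "seed_point a b 0 = b"
  by (simp add: seed_point.simps)

lemma seed_point_minus_1: "seed_point a b (-1) = a"
  by (simp add: seed_point.simps)

lemma T_seed_point:
  assumes "a \<in> S" "b \<in> S"
  shows "T (seed_point a b) = seed_point a b"
proof
  fix n
  have "-1 mod L = L - 1" "-1 div L = -1"
    using L_ge by (auto simp: zmod_minus1 div_eq_minus1)
  then show "T (seed_point a b) n = seed_point a b n"
    using assms p_id by (subst seed_point.simps) (auto simp: T_def seed_point_0 seed_point_minus_1)
qed

lemma T_funpow_seed_point:
  assumes "a \<in> S" "b \<in> S"
  shows "(T ^^ n) (seed_point a b) = seed_point a b"
  using T_seed_point[OF assms] by (induction n) simp_all

lemma L_power_greater: "\<exists>n. r < L ^ n"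
proof -
  have "r \<le> int (nat \<bar>r\<bar>)" by simp
  also have "\<dots> < int (nat L ^ nat \<bar>r\<bar>)"
    unfolding of_nat_less_iff by (rule power_gt_expt) (use L_ge in simp)
  finally show ?thesis using L_pos by auto
qed

text \<open>The two letters are neighbours in the image of \<open>c\<close>, so their blocks of
  level \<open>n\<close> are neighbours in its block of level \<open>n + 1\<close>. The origin sits
  at the cut \<open>(i + 1) * L ^ n\<close>.\<close>

lemma seed_point_in_X:
  assumes c: "c \<in> S" and i: "0 \<le> i" "i + 1 < L"
  shows "seed_point (p i c) (p (i + 1) c) \<in> X"
proof -
  let ?a = "p i c" and ?b = "p (i + 1) c"
  have S: "?a \<in> S" "?b \<in> S" using assms p_in by auto
  have blk: "seed_point ?a ?b k = P (Suc n) (k + (i + 1) * L ^ n) c" if k: "- (L ^ n) \<le> k" "k < L ^ n" for k n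
  proof (cases "k < 0")
    case True
    have "seed_point ?a ?b k = (T ^^ n) (seed_point ?a ?b) ((-1) * L ^ n + (k + L ^ n))"
      using T_funpow_seed_point[OF S] by simp
    also have "\<dots> = P n (k + L ^ n) ?a"
      using k True by (subst T_funpow_block) (simp_all add: seed_point_minus_1)
    also have "\<dots> = P (Suc n) (i * L ^ n + (k + L ^ n)) c"
      using k True i by (subst P_Suc_block) simp_all
    finally show ?thesis by (simp only: algebra_simps) simp
  next
    case False
    have "seed_point ?a ?b k = (T ^^ n) (seed_point ?a ?b) (0 * L ^ n + k)"
      using T_funpow_seed_point[OF S] by simp
    also have "\<dots> = P n k ?b"
      using k False by (subst T_funpow_block) (simp_all add: seed_point_0)
    also have "\<dots> = P (Suc n) ((i + 1) * L ^ n + k) c"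
      using k False i by (subst P_Suc_block) simp_all
    finally show ?thesis by (simp only: algebra_simps)
  qed
  show ?thesis
    unfolding X_iff
  proof (intro conjI allI)
    fix k
    obtain n where "\<bar>k\<bar> < L ^ n" using L_power_greater by blast
    then have "- (L ^ n) \<le> k" "k < L ^ n" by auto
    then show "seed_point ?a ?b k \<in> S" using blk[of n k] T_funpow_in[of "\<lambda>_. c" "Suc n"] c by metis
  next
    fix r
    obtain n where n: "r < L ^ n" using L_power_greater by blast
    have "1 * L ^ n \<le> (i + 1) * L ^ n" using i L_pos by (intro mult_right_mono) auto
    moreover have "(i + 2) * L ^ n \<le> L * L ^ n" using i L_pos by (intro mult_right_mono) auto
    ultimately show "\<exists>n a e. a \<in> S \<and> 0 \<le> e - r \<and> e + r \<le> L ^ n \<and>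
        (\<forall>k. -r \<le> k \<and> k < r \<longrightarrow> seed_point ?a ?b k = P n (k + e) a)"
      using c n blk[of n] by (intro exI[of _ "Suc n"] exI[of _ c] exI[of _ "(i + 1) * L ^ n"])
        (auto simp: algebra_simps)
  qed
qed

section \<open>Left-asymptotic pairs\<close>

lemma asymptotic_desubst:
  assumes x: "x \<in> X" "x' \<in> X" and eq: "\<And>n. n < 0 \<Longrightarrow> x n = x' n" and ne: "x 0 \<noteq> x' 0"
  shows "\<exists>y y'. y \<in> X \<and> y' \<in> X \<and> (\<forall>n<0. y n = y' n) \<and> y 0 \<noteq> y' 0 \<and> x = T y \<and>
    y 0 = x 0 \<and> y (-1) = x (-1)"
proof -
  obtain c y where c: "0 \<le> c" "c < L" and y: "y \<in> X" and xy: "\<And>n. x n = T y (n - c)"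
    using desubst[OF x(1)] by blast
  obtain c' y' where c': "0 \<le> c'" "c' < L" and y': "y' \<in> X" and xy': "\<And>n. x' n = T y' (n - c')"
    using desubst[OF x(2)] by blast
  note S = X_in[OF y] X_in[OF y']
  have cc: "c' = c"
    using phase_unique[of y y' c c' 0] S c c' eq unfolding xy xy' by simp
  have y_at: "y j = x (c + j * L)" "y' j = x' (c + j * L)" for j
    using T_at[of 0 y j] T_at[of 0 y' j] p_id[of 0] S L_pos by (simp_all add: xy xy' cc)
  \<comment> \<open>Otherwise the block around 0 starts at \<open>c - L\<close>, where the two
    points still agree, and that letter determines the letter at 0.\<close>
  have "c = 0"
  proof (rule ccontr)
    assume "c \<noteq> 0"
    then have k: "0 \<le> L - c" "L - c < L" using c by auto
    have "y (-1) = y' (-1)" unfolding y_at using eq c by simp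
    moreover have "x 0 = p (L - c) (y (-1))" "x' 0 = p (L - c) (y' (-1))"
      using T_at[OF k, of y "-1"] T_at[OF k, of y' "-1"] by (simp_all add: xy xy' cc)
    ultimately show False using ne by simp
  qed
  then have xT: "x = T y" using xy by auto
  have "y n = y' n" if "n < 0" for n
    using eq[of "n * L"] that L_pos unfolding y_at \<open>c = 0\<close> by (simp add: mult_neg_pos)
  moreover have "y 0 = x 0" "y 0 \<noteq> y' 0"
    using ne by (simp_all add: y_at \<open>c = 0\<close>)
  moreover have "y (-1) = x (-1)"
    using T_at[of "L - 1" y "-1"] p_id[of "L - 1" "y (-1)"] L_pos S by (simp add: xT)
  ultimately show ?thesis using y y' xT by blast
qed

text \<open>
  Two distinct points that agree to the left of \<open>0\<close> must have a cut at \<open>0\<close> on every level,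
  because a letter determines the rest of its block. Hence both are fixed by the substitution.
\<close>

lemma asymptotic_seed_point:
  assumes "x \<in> X" "x' \<in> X" "\<And>n. n < 0 \<Longrightarrow> x n = x' n" "x 0 \<noteq> x' 0"
  shows "x n = seed_point (x (-1)) (x 0) n"
  using assms
proof (induction "nat \<bar>n\<bar>" arbitrary: n x x' rule: less_induct)
  case less
  show ?case
  proof (cases "n = 0 \<or> n = -1")
    case True
    then show ?thesis by (auto simp: seed_point_0 seed_point_minus_1)
  next
    case False
    obtain y y' where y: "y \<in> X" "y' \<in> X" "\<forall>n<0. y n = y' n" "y 0 \<noteq> y' 0"
      and xy: "x = T y" and yx: "y 0 = x 0" "y (-1) = x (-1)"
      using asymptotic_desubst[OF less.prems] by blast
    have "\<bar>n div L\<bar> < \<bar>n\<bar>" using abs_div_less[of L n] L_ge False by simp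
    then have "y (n div L) = seed_point (y (-1)) (y 0) (n div L)"
      using y by (intro less.hyps[of _ y y']) auto
    moreover have "x n = p (n mod L) (y (n div L))" by (simp add: xy T_def)
    ultimately have "x n = p (n mod L) (seed_point (x (-1)) (x 0) (n div L))" by (simp only: yx)
    then show ?thesis using False by (subst seed_point.simps) simp
  qed
qed

subsection \<open>Automorphisms\<close>

text \<open>Division keeps negative positions negative until -1 is reached, so the right letter of
  the seed never enters. Two seeds with the same left letter thus give an asymptotic pair.\<close>

lemma seed_point_neg: "n < 0 \<Longrightarrow> seed_point a b n = seed_point a b' n"
proof (induction "nat \<bar>n\<bar>" arbitrary: n rule: less_induct)
  case less
  show ?case
  proof (cases "n = -1")
    case False
    then have "\<bar>n div L\<bar> < \<bar>n\<bar>" using abs_div_less[of L n] L_ge less.prems by simp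
    moreover have "n div L < 0" using less.prems L_pos by (intro div_neg_pos_less0)
    ultimately have "seed_point a b (n div L) = seed_point a b' (n div L)"
      by (intro less.hyps) auto
    then show ?thesis using less.prems False by (subst (1 2) seed_point.simps) simp
  qed (simp add: seed_point_minus_1)
qed

lemma compact_space_X: "compact_space (shift_topology S X)"
proof (rule compact_space_shift_topology[OF finite_S X_subset])
  fix z assume z: "z \<in> UNIV \<rightarrow> S" and approx: "\<And>r. \<exists>y\<in>X. \<forall>i. \<bar>i\<bar> \<le> r \<longrightarrow> y i = z i"
  show "z \<in> X" by (rule X_limit[OF _ approx]) (use z in auto)
qed

lemma automorphism_eq_letter_map:
  assumes f: "f \<in> carrier (shift_aut S X)"
  shows "\<exists>m \<phi>. \<phi> \<in> S \<rightarrow> S \<and>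
    (\<forall>i s. 0 \<le> i \<longrightarrow> i < L \<longrightarrow> s \<in> S \<longrightarrow> \<phi> (p i s) = p i (\<phi> s)) \<and>
    (\<forall>x\<in>X. f x = (\<lambda>n. \<phi> (x (n + m))))"
proof -
  have bij: "bij_betw f X X" and cont: "continuous_map (shift_topology S X) (shift_topology S X) f"
    and comm: "\<And>x. x \<in> X \<Longrightarrow> f (shift x) = shift (f x)"
    using f by (auto simp: shift_aut_def Bij_def homeomorphic_imp_continuous_map)
  have fX: "f x \<in> X" if "x \<in> X" for x using bij that by (rule bij_betw_apply)
  have f_shift: "f (\<lambda>n. x (n + m)) = (\<lambda>n. f x (n + m))" if "x \<in> X" for x m
    using shift_invariant_map[of X f x m] X_shift comm that by blast
  obtain r0 where r0: "\<And>x y. x \<in> X \<Longrightarrow> y \<in> X \<Longrightarrow> (\<And>i. \<bar>i\<bar> \<le> r0 \<Longrightarrow> x i = y i) \<Longrightarrow> f x 0 = f y 0"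
    using shift_local_rule[OF compact_space_X X_subset cont] by blast
  \<comment> \<open>\<open>r0\<close> may be negative; the positions chosen below need a nonnegative
    radius.\<close>
  define r where "r = \<bar>r0\<bar>"
  have local_f: "f x n = f y n" if xy: "x \<in> X" "y \<in> X" "\<And>i. \<bar>i - n\<bar> \<le> r \<Longrightarrow> x i = y i" for x y n
  proof -
    have "f (\<lambda>i. x (i + n)) 0 = f (\<lambda>i. y (i + n)) 0"
      using xy by (intro r0 X_shift) (auto simp: r_def)
    then show ?thesis using f_shift[OF xy(1), of n] f_shift[OF xy(2), of n] by simp
  qed

  obtain c where c: "c \<in> S" using S_ne by blast
  \<comment> \<open>The seeds are the neighbouring columns 0, 1 and 3, 4 of the image of
    \<open>c\<close>. Columns 0, 1 and 3 are the identity and column 4 differs from column 3, so the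
    points first differ at 0.\<close>
  define u u' where "u = seed_point c c" and "u' = seed_point c (p 4 c)"
  have u: "u \<in> X" and u': "u' \<in> X"
    using seed_point_in_X[OF c, of 0] seed_point_in_X[OF c, of 3] p_id c L_ge
    by (simp_all add: u_def u'_def)
  have Tu: "T u = u" and Tnu: "\<And>n. (T ^^ n) u = u"
    using T_seed_point[OF c c] T_funpow_seed_point[OF c c] by (simp_all add: u_def)
  have "u 0 \<noteq> u' 0"
    using p_ne[of 3 c] p_id[of 3 c] c L_ge by (simp add: u_def u'_def seed_point_0)
  then have "f u \<noteq> f u'" using bij u u' by (metis bij_betw_imp_inj_on inj_onD)
  then obtain n0 where n0: "f u n0 \<noteq> f u' n0" by blast
  have left: "f u n = f u' n" if "n < - r" for n
    using that by (intro local_f u u') (auto simp: u_def u'_def intro: seed_point_neg)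
  \<comment> \<open>The images agree to the left of \<open>-r\<close>; counting from there turns the
    first difference into a least natural number.\<close>
  define k0 where "k0 = (LEAST k. f u (int k - r) \<noteq> f u' (int k - r))"
  define i0 where "i0 = int k0 - r"
  have "\<not> n0 < - r" using left n0 by blast
  then have "f u (int (nat (n0 + r)) - r) \<noteq> f u' (int (nat (n0 + r)) - r)" using n0 by simp
  then have i0: "f u i0 \<noteq> f u' i0"
    unfolding i0_def k0_def by (rule LeastI)
  have below: "f u n = f u' n" if "n < i0" for n
  proof (cases "n < - r")
    case False
    then have "nat (n + r) < k0" using that by (simp add: i0_def)
    then show ?thesis using not_less_Least False unfolding k0_def by fastforce
  qed (rule left)

  \<comment> \<open>With the first difference moved to 0, \<open>v\<close> is one half of an
    asymptotic pair and hence fixed by \<open>T\<close>.\<close>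
  define v where "v n = f u (n + i0)" for n
  have v: "v \<in> X" unfolding v_def by (intro X_shift fX u)
  have "v n = seed_point (v (-1)) (v 0) n" for n
    by (rule asymptotic_seed_point[OF v X_shift[OF fX[OF u'], of i0]])
      (use below i0 in \<open>auto simp: v_def\<close>)
  then have v_eq: "v = seed_point (v (-1)) (v 0)" by blast
  then have Tv: "T v = v" and Tnv: "\<And>n. (T ^^ n) v = v"
    using T_seed_point T_funpow_seed_point X_in[OF v] by metis+

  have letter: "v j = v j'" if "u j = u j'" for j j'
  proof -
    \<comment> \<open>With this choice the window of radius \<open>r\<close> about
      \<open>t + i0\<close> lies between 0 and \<open>2 * t\<close>, hence inside one block of level
      \<open>n\<close>. Equal letters of \<open>u\<close> have equal blocks, so \<open>v\<close>
      agrees at the matching places, and injectivity of the column leads back to its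
      letters.\<close>
    define t where "t = r + \<bar>i0\<bar>"
    obtain n where n: "2 * t < L ^ n" using L_power_greater by blast
    have t: "0 \<le> t" "t < L ^ n" using n by (auto simp: t_def r_def)
    let ?x = "\<lambda>j i. u (i + j * L ^ n)"
    have v_at: "v (j * L ^ n + t) = f (?x j) (t + i0)" for j
      using f_shift[OF u, of "j * L ^ n"] by (simp add: v_def algebra_simps)
    have u_at: "u (i + j * L ^ n) = P n i (u j)" if "0 \<le> i" "i < L ^ n" for i j
      using T_funpow_block[OF that, of u j] by (simp add: Tnu add.commute)
    have "f (?x j) (t + i0) = f (?x j') (t + i0)"
    proof (rule local_f)
      fix i assume "\<bar>i - (t + i0)\<bar> \<le> r"
      then have i: "0 \<le> i" "i < L ^ n" using n by (auto simp: t_def)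
      show "?x j i = ?x j' i" using u_at[OF i] \<open>u j = u j'\<close> by simp
    qed (intro X_shift u)+
    then have "v (j * L ^ n + t) = v (j' * L ^ n + t)" by (simp only: v_at)
    moreover have "v (j * L ^ n + t) = P n t (v j)" for j
      using T_funpow_block[OF t, of v j] by (simp add: Tnv)
    ultimately have "P n t (v j) = P n t (v j')" by simp
    then show ?thesis by (rule P_inj[OF X_in[OF v] X_in[OF v]])
  qed
  \<comment> \<open>Any occurrence of \<open>s\<close> in \<open>u\<close> will do, by
    \<open>letter\<close>.\<close>
  define \<phi> where "\<phi> s = v (SOME j. u j = s)" for s
  have \<phi>_u: "\<phi> (u j) = v j" for j
    unfolding \<phi>_def by (rule letter, rule someI) simp
  have u_onto: "\<exists>j. u j = s" if s: "s \<in> S" for s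
  proof -
    obtain i where "0 \<le> i" "i < L" "p i c = s" using p_onto[OF c s] by blast
    then have "T u i = s" using T_at[of i u 0] by (simp add: u_def seed_point_0)
    then show ?thesis using Tu by auto
  qed
  have fu: "f u n = \<phi> (u (n - i0))" for n
    by (simp add: \<phi>_u v_def)
  show ?thesis
  proof (intro exI conjI allI impI ballI)
    show "\<phi> \<in> S \<rightarrow> S"
    proof
      fix s assume "s \<in> S"
      then obtain j where "u j = s" using u_onto by blast
      then show "\<phi> s \<in> S" using \<phi>_u[of j] X_in[OF v] by simp
    qed
    fix i s assume i: "0 \<le> i" "i < L" and "s \<in> S"
    then obtain j where j: "u j = s" using u_onto by blast
    \<comment> \<open>Since \<open>T\<close> fixes both \<open>u\<close> and \<open>v\<close>, each
      carries at \<open>j * L + i\<close> column \<open>i\<close> of its own letter at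
      \<open>j\<close>.\<close>
    have "\<phi> (u (j * L + i)) = v (j * L + i)" by (rule \<phi>_u)
    also have "v (j * L + i) = p i (v j)" using T_at[OF i, of v j] Tv by simp
    also have "v j = \<phi> (u j)" by (simp add: \<phi>_u)
    also have "u (j * L + i) = p i (u j)" using T_at[OF i, of u j] Tu by simp
    finally show "\<phi> (p i s) = p i (\<phi> s)" unfolding j .
  next
    fix x assume x: "x \<in> X"
    show "f x = (\<lambda>n. \<phi> (x (n + (- i0))))"
    proof
      fix n
      \<comment> \<open>A translate of \<open>u\<close> that agrees with \<open>x\<close> both on
        the window deciding \<open>f x n\<close> and at \<open>n - i0\<close>.\<close>
      obtain m where m: "\<And>k. \<bar>k\<bar> \<le> \<bar>n\<bar> + \<bar>i0\<bar> + r \<Longrightarrow> u (k + m) = x k"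
        using uniform_recurrence[OF u x] by blast
      have "f x n = f (\<lambda>k. u (k + m)) n"
        by (rule local_f[OF x X_shift[OF u]], rule m[symmetric]) auto
      also have "\<dots> = f u (n + m)" using f_shift[OF u, of m] by simp
      also have "\<dots> = \<phi> (u (n - i0 + m))" by (simp add: fu algebra_simps)
      also have "u (n - i0 + m) = x (n - i0)" by (rule m) (auto simp: r_def)
      finally show "f x n = \<phi> (x (n + (- i0)))" by simp
    qed
  qed
qed

end

section \<open>The automorphism group when a free action is the centralizer of the columns\<close>

locale equivariant_substitution = bijective_substitution S L p + group G
  for S :: "'a set" and L p and G :: "('g, 'm) monoid_scheme" (structure) +
  fixes act :: "'g \<Rightarrow> 'a \<Rightarrow> 'a"
  assumes act_in: "\<And>g s. g \<in> carrier G \<Longrightarrow> s \<in> S \<Longrightarrow> act g s \<in> S"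
    and act_mult: "\<And>g h s. g \<in> carrier G \<Longrightarrow> h \<in> carrier G \<Longrightarrow> s \<in> S \<Longrightarrow>
      act (g \<otimes> h) s = act g (act h s)"
    and act_one: "\<And>s. s \<in> S \<Longrightarrow> act \<one> s = s"
    and act_free: "\<And>g h s. g \<in> carrier G \<Longrightarrow> h \<in> carrier G \<Longrightarrow> s \<in> S \<Longrightarrow> act g s = act h s \<Longrightarrow> g = h"
    and act_p: "\<And>g i s. g \<in> carrier G \<Longrightarrow> 0 \<le> i \<Longrightarrow> i < L \<Longrightarrow> s \<in> S \<Longrightarrow> act g (p i s) = p i (act g s)"
    and centralizer: "\<And>\<phi>. \<phi> \<in> S \<rightarrow> S \<Longrightarrow>
      (\<And>i s. 0 \<le> i \<Longrightarrow> i < L \<Longrightarrow> s \<in> S \<Longrightarrow> \<phi> (p i s) = p i (\<phi> s)) \<Longrightarrow>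
      \<exists>g\<in>carrier G. \<forall>s\<in>S. \<phi> s = act g s"
begin

text \<open>Restricting to \<open>X\<close> makes the map extensional, as the elements of
  \<open>Bij X\<close> are.\<close>

definition \<Phi> :: "int \<times> 'g \<Rightarrow> (int \<Rightarrow> 'a) \<Rightarrow> int \<Rightarrow> 'a" where
  "\<Phi> kg = (\<lambda>x\<in>X. \<lambda>n. act (snd kg) (x (n + fst kg)))"

lemma P_act:
  assumes g: "g \<in> carrier G" and s: "s \<in> S"
  shows "P n k (act g s) = act g (P n k s)"
proof (induction n arbitrary: k)
  case (Suc n)
  then show ?case
    using L_pos g s by (simp only: T_funpow_Suc) (simp add: act_p T_funpow_in)
qed simp

text \<open>A letter map that commutes with the columns takes blocks of \<open>a\<close> to blocks
  of \<open>act g a\<close>.\<close>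

lemma act_X:
  assumes g: "g \<in> carrier G" and x: "x \<in> X"
  shows "(\<lambda>n. act g (x n)) \<in> X"
  unfolding X_iff
proof (intro conjI allI)
  show "act g (x n) \<in> S" for n using act_in[OF g X_in[OF x]] .
  fix r
  obtain n a e where a: "a \<in> S" and e: "0 \<le> e - r" "e + r \<le> L ^ n"
      and eq: "\<forall>k. -r \<le> k \<and> k < r \<longrightarrow> x k = P n (k + e) a"
    using X_window[OF x, of r] by (elim exE conjE) (rule that)
  show "\<exists>n a e. a \<in> S \<and> 0 \<le> e - r \<and> e + r \<le> L ^ n \<and>
      (\<forall>k. -r \<le> k \<and> k < r \<longrightarrow> act g (x k) = P n (k + e) a)"
    using act_in[OF g a] e eq P_act[OF g a]
    by (intro exI[of _ n] exI[of _ "act g a"] exI[of _ e]) simp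
qed

lemma \<Phi>_X: "g \<in> carrier G \<Longrightarrow> x \<in> X \<Longrightarrow> \<Phi> (k, g) x \<in> X"
  using act_X[OF _ X_shift] by (simp add: \<Phi>_def)

lemma \<Phi>_mult:
  assumes "g \<in> carrier G" "h \<in> carrier G" "x \<in> X"
  shows "\<Phi> (k, g) (\<Phi> (l, h) x) = \<Phi> (k + l, g \<otimes> h) x"
  using assms \<Phi>_X[OF assms(2,3), of l] X_in[OF assms(3)]
  by (simp add: \<Phi>_def act_mult algebra_simps)

lemma \<Phi>_one: "x \<in> X \<Longrightarrow> \<Phi> (0, \<one>) x = x"
  using X_in by (simp add: \<Phi>_def act_one)

lemma \<Phi>_continuous:
  assumes g: "g \<in> carrier G"
  shows "continuous_map (shift_topology S X) (shift_topology S X) (\<Phi> (k, g))"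
  unfolding continuous_map_def topspace_shift_topology[OF X_subset]
proof (intro conjI allI impI)
  show "\<Phi> (k, g) \<in> X \<rightarrow> X" using \<Phi>_X[OF g] by blast
  fix U assume "openin (shift_topology S X) U"
  note U = this[unfolded openin_shift_topology[OF X_subset], THEN conjunct2]
  show "openin (shift_topology S X) {x \<in> X. \<Phi> (k, g) x \<in> U}"
    unfolding openin_shift_topology[OF X_subset]
  proof (intro conjI ballI)
    fix x assume "x \<in> {x \<in> X. \<Phi> (k, g) x \<in> U}"
    then have x: "x \<in> X" "\<Phi> (k, g) x \<in> U" by auto
    then obtain r where r: "\<And>y. y \<in> X \<Longrightarrow> (\<And>i. \<bar>i\<bar> \<le> r \<Longrightarrow> y i = \<Phi> (k, g) x i) \<Longrightarrow> y \<in> U"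
      using U by blast
    have "\<Phi> (k, g) y \<in> U" if y: "y \<in> X" "\<forall>i. \<bar>i\<bar> \<le> r + \<bar>k\<bar> \<longrightarrow> y i = x i" for y
    proof (rule r[OF \<Phi>_X[OF g y(1)]])
      fix i assume "\<bar>i\<bar> \<le> r"
      then have "y (i + k) = x (i + k)" using y(2) by auto
      then show "\<Phi> (k, g) y i = \<Phi> (k, g) x i" using x y by (simp add: \<Phi>_def)
    qed
    then show "\<exists>r. \<forall>y\<in>X. (\<forall>i. \<bar>i\<bar> \<le> r \<longrightarrow> y i = x i) \<longrightarrow> y \<in> {x \<in> X. \<Phi> (k, g) x \<in> U}"
      by blast
  qed auto
qed

lemma \<Phi>_aut:
  assumes g: "g \<in> carrier G"
  shows "\<Phi> (k, g) \<in> carrier (shift_aut S X)"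
proof -
  have inv: "\<Phi> (k, g) (\<Phi> (- k, inv g) x) = x" "\<Phi> (- k, inv g) (\<Phi> (k, g) x) = x" if "x \<in> X" for x
    using that g by (simp_all add: \<Phi>_mult \<Phi>_one)
  have "bij_betw (\<Phi> (k, g)) X X"
    by (rule bij_betw_byWitness[of _ "\<Phi> (- k, inv g)"]) (use inv \<Phi>_X g in auto)
  then have "\<Phi> (k, g) \<in> Bij X" by (simp add: Bij_def \<Phi>_def)
  moreover have "homeomorphic_map (shift_topology S X) (shift_topology S X) (\<Phi> (k, g))"
    unfolding homeomorphic_map_maps homeomorphic_maps_def topspace_shift_topology[OF X_subset]
    by (rule exI[of _ "\<Phi> (- k, inv g)"]) (use inv \<Phi>_continuous g in auto)
  moreover have "\<Phi> (k, g) (shift x) = shift (\<Phi> (k, g) x)" if "x \<in> X" for x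
    using that X_shift[OF that, of 1] by (simp add: \<Phi>_def shift_def algebra_simps)
  ultimately show ?thesis by (simp add: shift_aut_def)
qed

text \<open>Evaluated at one point, equality makes the shift by \<open>k - l\<close> act as a letter
  map. By aperiodicity \<open>k = l\<close>, and freeness of the action gives
  \<open>g = h\<close>.\<close>

lemma \<Phi>_inj:
  assumes g: "g \<in> carrier G" "h \<in> carrier G" and eq: "\<Phi> (k, g) = \<Phi> (l, h)"
  shows "k = l \<and> g = h"
proof -
  obtain c where c: "c \<in> S" using S_ne by blast
  obtain x where xX: "x \<in> X"
    using seed_point_in_X[OF c, of 0] L_ge by auto
  have e: "act g (x (n + k)) = act h (x (n + l))" for n
    using fun_cong[OF fun_cong[OF eq], of x n] xX by (simp add: \<Phi>_def)
  have "x (n + (k - l)) = act (inv g \<otimes> h) (x n)" for n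
  proof -
    have "act (inv g) (act g (x (n - l + k))) = act (inv g) (act h (x (n - l + l)))"
      using e[of "n - l"] by simp
    then show ?thesis
      using g X_in[OF xX] by (simp add: act_mult[symmetric] act_one algebra_simps)
  qed
  moreover have "inj_on (act (inv g \<otimes> h)) S"
  proof (rule inj_onI)
    fix s t assume st: "s \<in> S" "t \<in> S" and "act (inv g \<otimes> h) s = act (inv g \<otimes> h) t"
    then have "act (inv (inv g \<otimes> h)) (act (inv g \<otimes> h) s) = act (inv (inv g \<otimes> h)) (act (inv g \<otimes> h) t)"
      by simp
    then show "s = t" using st g by (simp add: act_mult[symmetric] act_one l_inv)
  qed
  moreover have "act (inv g \<otimes> h) \<in> S \<rightarrow> S" using g act_in by auto
  ultimately have "k - l = 0" by (intro aperiodic[OF xX])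
  then have "k = l" by simp
  moreover have "g = h" using act_free[OF g X_in[OF xX]] e \<open>k = l\<close> by blast
  ultimately show ?thesis by blast
qed

theorem shift_aut_iso: "shift_aut S X \<cong> integer_group \<times>\<times> G"
proof -
  have mult: "f \<otimes>\<^bsub>shift_aut S X\<^esub> f' = compose X f f'"
    if "f \<in> carrier (shift_aut S X)" "f' \<in> carrier (shift_aut S X)" for f f'
    using that by (simp add: shift_aut_def BijGroup_def)
  have "\<Phi> \<in> iso (integer_group \<times>\<times> G) (shift_aut S X)"
    unfolding iso_def
  proof (intro CollectI conjI)
    show "\<Phi> \<in> hom (integer_group \<times>\<times> G) (shift_aut S X)"
    proof (rule homI)
      fix a assume "a \<in> carrier (integer_group \<times>\<times> G)"
      then show "\<Phi> a \<in> carrier (shift_aut S X)" using \<Phi>_aut by (cases a) auto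
    next
      fix a b assume ab: "a \<in> carrier (integer_group \<times>\<times> G)" "b \<in> carrier (integer_group \<times>\<times> G)"
      obtain k g l h where e: "a = (k, g)" "b = (l, h)" by (cases a, cases b)
      have gh: "g \<in> carrier G" "h \<in> carrier G" using ab by (auto simp: e)
      have "\<Phi> (k + l, g \<otimes> h) = compose X (\<Phi> (k, g)) (\<Phi> (l, h))"
      proof (rule extensionalityI)
        show "\<Phi> (k + l, g \<otimes> h) \<in> extensional X" by (simp add: \<Phi>_def)
      qed (use \<Phi>_mult gh in \<open>auto simp: compose_def\<close>)
      then show "\<Phi> (a \<otimes>\<^bsub>integer_group \<times>\<times> G\<^esub> b) = \<Phi> a \<otimes>\<^bsub>shift_aut S X\<^esub> \<Phi> b"
        using mult \<Phi>_aut gh by (simp add: e)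
    qed
    show "bij_betw \<Phi> (carrier (integer_group \<times>\<times> G)) (carrier (shift_aut S X))"
      unfolding bij_betw_def
    proof
      show "inj_on \<Phi> (carrier (integer_group \<times>\<times> G))"
        by (rule inj_onI) (use \<Phi>_inj in \<open>auto simp: DirProd_def\<close>)
      show "\<Phi> ` carrier (integer_group \<times>\<times> G) = carrier (shift_aut S X)"
      proof
        show "\<Phi> ` carrier (integer_group \<times>\<times> G) \<subseteq> carrier (shift_aut S X)"
          using \<Phi>_aut by auto
        show "carrier (shift_aut S X) \<subseteq> \<Phi> ` carrier (integer_group \<times>\<times> G)"
        proof
          fix f assume f: "f \<in> carrier (shift_aut S X)"
          obtain m \<phi> where \<phi>: "\<phi> \<in> S \<rightarrow> S"
            "\<forall>i s. 0 \<le> i \<longrightarrow> i < L \<longrightarrow> s \<in> S \<longrightarrow> \<phi> (p i s) = p i (\<phi> s)"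
            and f_eq: "\<forall>x\<in>X. f x = (\<lambda>n. \<phi> (x (n + m)))"
            using automorphism_eq_letter_map[OF f] by (elim exE conjE) (rule that)
          obtain g where g: "g \<in> carrier G" "\<And>s. s \<in> S \<Longrightarrow> \<phi> s = act g s"
            using centralizer[of \<phi>] \<phi> by blast
          have "f = \<Phi> (m, g)"
          proof (rule extensionalityI)
            show "f \<in> extensional X" using f by (simp add: shift_aut_def Bij_def)
            show "\<Phi> (m, g) \<in> extensional X" by (simp add: \<Phi>_def)
            show "f x = \<Phi> (m, g) x" if "x \<in> X" for x
              using f_eq g(2) X_in[OF that] that by (simp add: \<Phi>_def)
          qed
          then show "f \<in> \<Phi> ` carrier (integer_group \<times>\<times> G)" using g(1) by auto
        qed
      qed
    qed
  qed
  then have "integer_group \<times>\<times> G \<cong> shift_aut S X" by (auto simp: is_iso_def)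
  moreover have "group (integer_group \<times>\<times> G)"
    by (intro DirProd_group group_integer_group group_axioms)
  ultimately show ?thesis by (simp add: group.iso_sym)
qed

end

section \<open>Columns with a prescribed centralizer\<close>

text \<open>
  The alphabet is a copy of \<open>G \<times> {0, 1, 2}\<close>, and the columns are the permutations
  \<open>(g, j) \<mapsto> (g h, \<pi> j)\<close>. The factor \<open>{0, 1, 2}\<close> is there because its symmetric group has
  trivial centralizer and contains a fixed-point-free element; it keeps the subshift
  infinite when \<open>G\<close> is trivial.
\<close>

lemma (in group) equivariant_substitution_exists:
  assumes fin: "finite (carrier G)"
  shows "\<exists>(S :: nat set) L p act. equivariant_substitution S L p G act"
proof -
  define B where "B = carrier G \<times> {..<3::nat}"
  have "finite B" using fin by (simp add: B_def)
  \<comment> \<open>The alphabet is to consist of natural numbers, so pairs are encoded.\<close>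
  obtain enc :: "'a \<times> nat \<Rightarrow> nat" where enc: "inj_on enc B"
    using finite_imp_inj_to_nat_seg[OF \<open>finite B\<close>] by (elim exE conjE) (rule that)
  define dec where "dec = inv_into B enc"
  have dec: "dec (enc b) = b" if "b \<in> B" for b
    using that enc by (simp add: dec_def)
  have enc_eq: "enc b = enc b' \<longleftrightarrow> b = b'" if "b \<in> B" "b' \<in> B" for b b'
    using that enc by (simp add: inj_on_eq_iff)
  define S where "S = enc ` B"
  have S_cases: "\<exists>g j. g \<in> carrier G \<and> j < 3 \<and> s = enc (g, j)" if "s \<in> S" for s
    using that by (auto simp: S_def B_def)
  have enc_S: "enc (g, j) \<in> S" if "g \<in> carrier G" "j < 3" for g j
    using that by (auto simp: S_def B_def)
  have dec': "dec (enc (g, j)) = (g, j)" if "g \<in> carrier G" "j < 3" for g j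
    using that by (intro dec) (simp add: B_def)
  have enc_eq': "enc (g, j) = enc (h, k) \<longleftrightarrow> g = h \<and> j = k"
    if "g \<in> carrier G" "j < 3" "h \<in> carrier G" "k < 3" for g h j k
    using that enc_eq by (simp add: B_def)
  \<comment> \<open>The group multiplies from the left and the columns from the right; associativity
    makes the two commute.\<close>
  define act where "act g s = enc (g \<otimes> fst (dec s), snd (dec s))" for g s
  define \<rho> where "\<rho> w s = enc (fst (dec s) \<otimes> fst w, snd w (snd (dec s)))" for w s
  define W where "W = carrier G \<times> {\<pi>. \<pi> permutes {..<3::nat}}"
  \<comment> \<open>A 3-cycle has no fixed point, so applying it after a column changes every
    letter, as \<open>p_ne\<close> demands.\<close>
  define rot where "rot j = (if j = 0 then 1 else if j = 1 then 2 else if j = 2 then 0 else j)" for j :: nat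
  have act: "act g (enc (h, j)) = enc (g \<otimes> h, j)" if "h \<in> carrier G" "j < 3" for g h j
    using that by (simp add: act_def dec')
  have \<rho>: "\<rho> w (enc (g, j)) = enc (g \<otimes> fst w, snd w j)" if "g \<in> carrier G" "j < 3" for w g j
    using that by (simp add: \<rho>_def dec')
  have W_less: "snd w j < 3" if "w \<in> W" "j < 3" for w j
  proof -
    have "snd w permutes {..<3}" using that by (auto simp: W_def)
    from permutes_in_image[OF this, of j] that show ?thesis by simp
  qed
  have W_G: "fst w \<in> carrier G" if "w \<in> W" for w
    using that by (auto simp: W_def)
  have rot: "(\<one>, rot) \<in> W"
  proof -
    have "bij_betw rot {..<3} {..<3}"
    proof (rule bij_betw_byWitness[where f' = "rot \<circ> rot"])
    qed (auto simp: rot_def)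
    then have "rot permutes {..<3}" by (rule bij_imp_permutes) (auto simp: rot_def)
    then show ?thesis by (simp add: W_def)
  qed
  have transpose: "(h, transpose j k) \<in> W" if "h \<in> carrier G" "j < 3" "k < 3" for h j k
    using that by (simp add: W_def permutes_swap_id)
  have \<rho>_bij: "bij_betw (\<rho> w) S S" if w: "w \<in> W" for w
  proof -
    have \<rho>S: "\<rho> w ` S \<subseteq> S"
    proof (rule image_subsetI)
      fix s assume "s \<in> S"
      then obtain g j where "g \<in> carrier G" "j < 3" "s = enc (g, j)" using S_cases by blast
      then show "\<rho> w s \<in> S" using W_less[OF w] W_G[OF w] by (simp add: \<rho> enc_S)
    qed
    have perm: "snd w permutes {..<3}" using w by (auto simp: W_def)
    have "inj_on (\<rho> w) S"
    proof (rule inj_onI)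
      fix s t assume st: "s \<in> S" "t \<in> S" "\<rho> w s = \<rho> w t"
      obtain g j h k where e: "g \<in> carrier G" "j < 3" "s = enc (g, j)"
        "h \<in> carrier G" "k < 3" "t = enc (h, k)"
        using S_cases[OF st(1)] S_cases[OF st(2)] by blast
      then have "enc (g \<otimes> fst w, snd w j) = enc (h \<otimes> fst w, snd w k)"
        using st(3) \<rho> by simp
      then have "g \<otimes> fst w = h \<otimes> fst w \<and> snd w j = snd w k"
        using e W_less[OF w] W_G[OF w] by (subst (asm) enc_eq') auto
      then show "s = t"
        using e W_G[OF w] permutes_inj[OF perm] by (auto dest: injD)
    qed
    moreover have "finite S" using \<open>finite B\<close> by (simp add: S_def)
    ultimately show ?thesis
      using \<rho>S by (simp add: bij_betw_def endo_inj_surj)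
  qed
  have act_\<rho>: "act g (\<rho> w s) = \<rho> w (act g s)" if g: "g \<in> carrier G" and w: "w \<in> W" and "s \<in> S" for g w s
  proof -
    obtain h j where "h \<in> carrier G" "j < 3" "s = enc (h, j)" using S_cases \<open>s \<in> S\<close> by blast
    then show ?thesis
      using g W_G[OF w] W_less[OF w] by (simp add: act \<rho> m_assoc)
  qed
  have id_W: "(\<one>, id) \<in> W" using permutes_id by (simp add: W_def)
  have \<rho>_id: "\<rho> (\<one>, id) s = s" if "s \<in> S" for s
    using S_cases[OF that] by (auto simp: \<rho>)
  have rot_ne: "\<rho> (\<one>, rot) s \<noteq> s" if "s \<in> S" for s
  proof -
    obtain h j where "h \<in> carrier G" "j < 3" "s = enc (h, j)" using S_cases \<open>s \<in> S\<close> by blast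
    moreover from this have "rot j < 3" "rot j \<noteq> j" by (auto simp: rot_def)
    ultimately show ?thesis by (simp add: \<rho> enc_eq')
  qed

  have "finite W" using fin by (simp add: W_def finite_permutations)
  then obtain qs where qs: "set qs = W" using finite_list by blast
  \<comment> \<open>The identity comes first so that column 3 is the identity.\<close>
  define ws where "ws = (\<one>, id) # qs"
  have ws: "set ws = W" using qs id_W by (auto simp: ws_def)
  \<comment> \<open>Three identity columns, then two for each entry of \<open>ws\<close>, namely
    \<open>2 * k + 3\<close> for entry \<open>k\<close> and its rotated copy, and one last identity
    column.\<close>
  define L where "L = 2 * int (length ws) + 4"
  define q where "q i = \<rho> (ws ! nat ((i - 3) div 2))" for i :: int
  define p where "p i = (if i < 3 \<or> i = L - 1 then \<rho> (\<one>, id)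
    else if odd i then q i else \<rho> (\<one>, rot) \<circ> q i)" for i :: int
  have ws_W: "ws ! nat ((i - 3) div 2) \<in> W" if "3 \<le> i" "i < L - 1" for i
    unfolding ws[symmetric] by (rule nth_mem) (use that in \<open>simp add: L_def; presburger\<close>)
  have p_comm: "act g (p i s) = p i (act g s)"
    if g: "g \<in> carrier G" and "0 \<le> i" "i < L" and s: "s \<in> S" for g i s
  proof -
    have "q i s \<in> S" if "3 \<le> i" "i < L - 1"
      using \<rho>_bij[OF ws_W[OF that]] s by (auto simp: q_def dest: bij_betw_apply)
    then show ?thesis
      using that ws_W[of i] by (auto simp: p_def q_def act_\<rho> id_W rot)
  qed
  have W_p: "\<exists>i\<ge>0. i < L \<and> p i = \<rho> w" if "w \<in> W" for w
  proof -
    obtain k where k: "k < length ws" "ws ! k = w" using \<open>w \<in> W\<close> ws by (metis in_set_conv_nth)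
    have "p (2 * int k + 3) = \<rho> w" using k by (simp add: p_def q_def L_def)
    moreover have "2 * int k + 3 < L" using k by (simp add: L_def)
    ultimately show ?thesis by (intro exI[of _ "2 * int k + 3"]) simp
  qed
  have "equivariant_substitution S L p G act"
  proof unfold_locales
    show "finite S" using \<open>finite B\<close> by (simp add: S_def)
    show "S \<noteq> {}" using enc_S[of \<one> 0] by auto
    show "6 \<le> L" by (simp add: L_def ws_def)
    show "even L" by (simp add: L_def)
  next
    fix i assume i: "0 \<le> i" "i < L"
    show "bij_betw (p i) S S"
    proof (cases "i < 3 \<or> i = L - 1")
      case True
      then show ?thesis using \<rho>_bij[OF id_W] by (auto simp: p_def)
    next
      case False
      then have "bij_betw (q i) S S" unfolding q_def using i by (intro \<rho>_bij ws_W) auto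
      then show ?thesis
        using False bij_betw_trans[of "q i" S S "\<rho> (\<one>, rot)" S] \<rho>_bij[OF rot] by (simp add: p_def)
    qed
  next
    fix i s assume i: "i \<in> {0, 1, 2, 3, L - 1}" and s: "s \<in> S"
    have "q 3 s = s" using \<rho>_id[OF s] by (simp add: q_def ws_def)
    then show "p i s = s" using i \<rho>_id[OF s] by (auto simp: p_def)
  next
    fix i s assume i: "odd i" "3 \<le> i" "i < L - 1" and s: "s \<in> S"
    have "(i + 1 - 3) div 2 = (i - 3) div 2" using i by presburger
    then have "q (i + 1) = q i" by (simp add: q_def)
    moreover have "q i s \<in> S"
      using \<rho>_bij[OF ws_W[OF i(2,3)]] s by (auto simp: q_def dest: bij_betw_apply)
    moreover have "i + 1 \<noteq> L - 1" using i by (auto simp: L_def)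
    ultimately show "p (i + 1) s \<noteq> p i s" using i rot_ne by (simp add: p_def)
  next
    fix s t assume st: "s \<in> S" "t \<in> S"
    obtain g j h k where e: "g \<in> carrier G" "j < 3" "s = enc (g, j)"
      "h \<in> carrier G" "k < 3" "t = enc (h, k)"
      using S_cases[OF st(1)] S_cases[OF st(2)] by blast
    have "\<rho> (inv g \<otimes> h, transpose j k) s = t"
      using e by (simp add: \<rho> m_assoc[symmetric])
    moreover have "(inv g \<otimes> h, transpose j k) \<in> W" using e by (intro transpose) auto
    ultimately show "\<exists>i\<ge>0. i < L \<and> p i s = t" using W_p by metis
  next
    show "act g s \<in> S" if "g \<in> carrier G" "s \<in> S" for g s
      using S_cases[OF that(2)] that(1) by (auto simp: act enc_S)
    show "act (g \<otimes> h) s = act g (act h s)" if "g \<in> carrier G" "h \<in> carrier G" "s \<in> S" for g h s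
      using S_cases[OF that(3)] that(1,2) by (auto simp: act m_assoc)
    show "act \<one> s = s" if "s \<in> S" for s
      using S_cases[OF that] by (auto simp: act)
    show "g = h" if "g \<in> carrier G" "h \<in> carrier G" "s \<in> S" "act g s = act h s" for g h s
      using S_cases[OF that(3)] that by (auto simp: act enc_eq')
    show "act g (p i s) = p i (act g s)" if "g \<in> carrier G" "0 \<le> i" "i < L" "s \<in> S" for g i s
      using p_comm that by blast
  next
    fix \<phi> assume \<phi>: "\<phi> \<in> S \<rightarrow> S"
      and comm: "\<And>i s. 0 \<le> i \<Longrightarrow> i < L \<Longrightarrow> s \<in> S \<Longrightarrow> \<phi> (p i s) = p i (\<phi> s)"
    have comm_\<rho>: "\<phi> (\<rho> w s) = \<rho> w (\<phi> s)" if "w \<in> W" "s \<in> S" for w s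
      using W_p[OF that(1)] comm that(2) by metis
    have s0: "enc (\<one>, 0) \<in> S" by (simp add: enc_S)
    then obtain g j where g: "g \<in> carrier G" "j < 3" "\<phi> (enc (\<one>, 0)) = enc (g, j)"
      using S_cases \<phi> by blast
    \<comment> \<open>This column fixes \<open>enc (\<one>, 0)\<close> and therefore also its image
      under \<open>\<phi>\<close>; the transposition fixes only 0 among 0, 1, 2.\<close>
    have "(\<one>, transpose 1 2) \<in> W" by (intro transpose) auto
    from comm_\<rho>[OF this s0] have "enc (g, j) = enc (g, transpose 1 2 j)"
      using g by (simp add: \<rho>)
    then have "j = transpose 1 2 j"
      using g by (subst (asm) enc_eq') (auto simp: transpose_def)
    then have j: "j = 0" using g(2) by (auto simp: transpose_def split: if_splits)
    show "\<exists>g\<in>carrier G. \<forall>s\<in>S. \<phi> s = act g s"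
    proof (intro bexI[of _ g] ballI)
      fix s assume "s \<in> S"
      then obtain h k where h: "h \<in> carrier G" "k < 3" "s = enc (h, k)" using S_cases by blast
      \<comment> \<open>This column carries \<open>enc (\<one>, 0)\<close> to \<open>s\<close>, so
        the image of one letter determines \<open>\<phi>\<close>.\<close>
      have "(h, transpose 0 k) \<in> W" using h by (intro transpose) auto
      from comm_\<rho>[OF this s0] show "\<phi> s = act g s"
        using g h by (simp add: \<rho> act j)
    qed (rule g(1))
  qed
  then show ?thesis by blast
qed

theorem theorem3p6:
  fixes G :: "('g, 'm) monoid_scheme"
  assumes "group G" and "finite (carrier G)"
  shows "\<exists>(A :: nat set) \<tau>. substitution A \<tau> \<and>
           minimal_shift A (subst_shift A \<tau>) \<and>
           shift_aut A (subst_shift A \<tau>) \<cong> integer_group \<times>\<times> G"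
proof -
  obtain S :: "nat set" and L p act where "equivariant_substitution S L p G act"
    using group.equivariant_substitution_exists[OF assms] by blast
  then interpret equivariant_substitution S L p G act .
  show ?thesis using substitution_\<tau> minimal_X shift_aut_iso by blast
qed

end
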